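(* For any sequence $\{r_{n,T}\}_{n,T\ge 1}$ increasing to infinity such that $r_{n,T}=o(n^{1/4})$, and if $\log(T)=o(n)$, then for every $\epsilon>0$ the maximum likelihood estimator $\hat\pi$ satisfies $$\mathbb{P}_{\theta^*}\left(\min_{\sigma\in\mathfrak{S}_Q}\|\pi^*-\hat\pi_\sigma\|_\infty>\frac{\epsilon\, r_{n,T}}{n^{1/4}}\right)\xrightarrow[n,T\to\infty]{}0 .$$
   Context: Notation: $[M]=\{1,\dots,M\}$. Fix the number of classes $Q\ge 2$ and constants $0<\delta<1/Q$, $0<\zeta<1/2$. Model. There are $n$ nodes observed at times $t=1,\dots,T$. The latent labels $Z_i=(Z_i^1,\dots,Z_i^T)$, $i\in[n]$, are i.i.d. homogeneous stationary Markov chains on $[Q]$ with transition matrix $\Gamma=(\gamma_{ql})_{q,l\in[Q]}$, $\gamma_{ql}=\mathbb{P}(Z_i^{t+1}=l\mid Z_i^t=q)$, started from the stationary distribution $\alpha=(\alpha_q)_{q\in[Q]}$ of $\Gamma$. Write $Z^t=(Z_1^t,\dots,Z_n^t)$, $Z^{1:T}=(Z^1,\dots,Z^T)$. The observations $X^{1:T}=(X^1,\dots,X^T)$ are symmetric binary adjacency matrices $X^t=(X^t_{ij})_{i,j\in[n]}$ with $X^t_{ii}=0$; conditionally on $Z^{1:T}$, the $X^t_{ij}$ ($i<j$, $t\in[T]$) are independent and $X^t_{ij}$ is Bernoulli with parameter $\pi_{Z^t_iZ^t_j}$, where $\pi=(\pi_{ql})$ is a symmetric $Q\times Q$ matrix.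 The parameter is $\theta=(\Gamma,\pi)$ and $\mathbb{P}_\theta$ is the law of all variables under $\theta$. $\Theta$ is the set of $\theta=(\Gamma,\pi)$ with $\Gamma$ stochastic and $\pi$ symmetric such that: for all $q\ne q'$ there is $l$ with $\pi_{ql}\neq\pi_{q'l}$; $\gamma_{ql}\in[\delta,1-\delta]$ for all $q,l$; $\pi_{ql}\in[\zeta,1-\zeta]$ for all $q,l$. The true parameter is $\theta^*=(\Gamma^*,\pi^* )\in\Theta$. The maximum likelihood estimator is $\hat\theta=(\hat\Gamma,\hat\pi)=\operatorname{argmax}_{\theta\in\Theta}\ell(\theta)$ with $\ell(\theta)=\log\mathbb{P}_\theta(X^{1:T})$. $\mathfrak{S}_Q$ is the set of permutations of $[Q]$, $\pi_\sigma=(\pi_{\sigma(q)\sigma(l)})_{q,l}$, and $\|\pi-\pi'\|_\infty=\max_{q,l}|\pi_{ql}-\pi'_{ql}|$. Asymptotics: limits and $o(\cdot)$ are for $n\to\infty$ and $T\to\infty$ jointly; $\log T=o(n)$ restricts the joint regime. A sequence increasing to infinity is a positive sequence tending to $+\infty$ in this regime. *)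

theory Defs
  imports
    "HOL-Probability.Probability"
    "HOL-Probability.Product_PMF"
    "HOL-Library.Landau_Symbols"
    "HOL-Combinatorics.Permutations"
begin

text \<open>
  The set of classes is a finite type \<open>'q\<close> with \<open>Q = CARD('q)\<close>. A parameter is a pair
  \<open>(\<Gamma>, \<pi>)\<close> of a transition matrix and a connection matrix. Nodes are \<open>1, \<dots>, n\<close> and
  times are \<open>1, \<dots>, T\<close>.
\<close>

type_synonym 'q param = "(real ^ 'q ^ 'q) \<times> (real ^ 'q ^ 'q)"

text \<open>\<open>z i t\<close> is the class of node \<open>i\<close> at time \<open>t\<close>.\<close>
type_synonym 'q labels = "nat \<Rightarrow> nat \<Rightarrow> 'q"

text \<open>\<open>x t i j\<close> says whether the edge between \<open>i\<close> and \<open>j\<close> is present at time \<open>t\<close>.\<close>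
type_synonym graphs = "nat \<Rightarrow> nat \<Rightarrow> nat \<Rightarrow> bool"

definition prob_vector :: "real ^ 'q \<Rightarrow> bool" where
  "prob_vector a \<longleftrightarrow> (\<forall>q. 0 \<le> a $ q) \<and> (\<Sum>q\<in>UNIV. a $ q) = 1"

definition stochastic :: "real ^ 'q ^ 'q \<Rightarrow> bool" where
  "stochastic \<Gamma> \<longleftrightarrow> (\<forall>q. prob_vector (\<Gamma> $ q))"

definition param_space :: "real \<Rightarrow> real \<Rightarrow> ('q::finite) param set" where
  "param_space \<delta> \<zeta> = {(\<Gamma>, \<pi>).
     stochastic \<Gamma> \<and> transpose \<pi> = \<pi> \<and>
     (\<forall>q q'. q \<noteq> q' \<longrightarrow> (\<exists>l. \<pi> $ q $ l \<noteq> \<pi> $ q' $ l)) \<and>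
     (\<forall>q l. \<Gamma> $ q $ l \<in> {\<delta>..1 - \<delta>}) \<and>
     (\<forall>q l. \<pi> $ q $ l \<in> {\<zeta>..1 - \<zeta>})}"

text \<open>Well defined for stochastic matrices with positive entries.\<close>
definition stationary_dist :: "real ^ 'q ^ 'q \<Rightarrow> real ^ ('q::finite)" where
  "stationary_dist \<Gamma> = (THE a. prob_vector a \<and> a v* \<Gamma> = a)"

text \<open>Meaningful only for probability vectors.\<close>
definition vec_pmf :: "real ^ 'q \<Rightarrow> ('q::finite) pmf" where
  "vec_pmf a = embed_pmf (\<lambda>q. a $ q)"

text \<open>
  The path \<open>(Z\<^sup>1, \<dots>, Z\<^sup>T)\<close> of one stationary chain; coordinates outside \<open>{1..T}\<close> are
  \<open>undefined\<close>.
\<close>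
primrec chain_pmf :: "real ^ 'q ^ 'q \<Rightarrow> nat \<Rightarrow> (nat \<Rightarrow> 'q::finite) pmf" where
  "chain_pmf \<Gamma> 0 = return_pmf (\<lambda>_. undefined)"
| "chain_pmf \<Gamma> (Suc t) =
     do {
       z \<leftarrow> chain_pmf \<Gamma> t;
       q \<leftarrow> vec_pmf (if t = 0 then stationary_dist \<Gamma> else \<Gamma> $ z t);
       return_pmf (z(Suc t := q))
     }"

definition labels_pmf :: "real ^ 'q ^ 'q \<Rightarrow> nat \<Rightarrow> nat \<Rightarrow> ('q::finite) labels pmf" where
  "labels_pmf \<Gamma> n T = Pi_pmf {1..n} (\<lambda>_. undefined) (\<lambda>_. chain_pmf \<Gamma> T)"

definition edge_index :: "nat \<Rightarrow> nat \<Rightarrow> (nat \<times> nat \<times> nat) set" where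
  "edge_index n T = {(t, i, j). t \<in> {1..T} \<and> i \<in> {1..n} \<and> j \<in> {1..n} \<and> i < j}"

text \<open>
  Conditional law of the observations given the labels. Independent entries are drawn for \<open>i < j\<close>
  and then symmetrised; \<open>(t, i, i)\<close> is never in \<open>edge_index n T\<close>, so the diagonal takes the
  default value \<open>False\<close>.
\<close>
definition graphs_pmf ::
    "real ^ 'q ^ 'q \<Rightarrow> nat \<Rightarrow> nat \<Rightarrow> ('q::finite) labels \<Rightarrow> graphs pmf" where
  "graphs_pmf \<pi> n T z =
     map_pmf (\<lambda>w t i j. w (t, min i j, max i j))
       (Pi_pmf (edge_index n T) False (\<lambda>(t, i, j). bernoulli_pmf (\<pi> $ z i t $ z j t)))"

definition dsbm_pmf :: "('q::finite) param \<Rightarrow> nat \<Rightarrow> nat \<Rightarrow> ('q labels \<times> graphs) pmf" where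
  "dsbm_pmf \<theta> n T =
     do {
       z \<leftarrow> labels_pmf (fst \<theta>) n T;
       x \<leftarrow> graphs_pmf (snd \<theta>) n T z;
       return_pmf (z, x)
     }"

definition log_lik :: "nat \<Rightarrow> nat \<Rightarrow> graphs \<Rightarrow> ('q::finite) param \<Rightarrow> real" where
  "log_lik n T x \<theta> = ln (measure_pmf.prob (dsbm_pmf \<theta> n T) {(z, x'). x' = x})"

text \<open>
  The condition that the rows of \<open>\<pi>\<close> be distinct is not closed, so for some observations (such as
  empty graphs) the likelihood has no maximiser over \<open>param_space \<delta> \<zeta>\<close>; maximisers are also
  never unique because of label switching. A maximum likelihood estimator is therefore any
  function of the observations which selects a maximiser whenever there is one.
\<close>
definition is_mle ::
    "real \<Rightarrow> real \<Rightarrow> (nat \<Rightarrow> nat \<Rightarrow> graphs \<Rightarrow> ('q::finite) param) \<Rightarrow> bool" where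
  "is_mle \<delta> \<zeta> est \<longleftrightarrow>
     (\<forall>n T x. (\<exists>\<theta> :: 'q param. is_arg_max (log_lik n T x) (\<lambda>\<theta>. \<theta> \<in> param_space \<delta> \<zeta>) \<theta>) \<longrightarrow>
        is_arg_max (log_lik n T x) (\<lambda>\<theta>. \<theta> \<in> param_space \<delta> \<zeta>) (est n T x))"

definition permute_mat :: "('q \<Rightarrow> 'q) \<Rightarrow> real ^ 'q ^ 'q \<Rightarrow> real ^ 'q ^ ('q::finite)" where
  "permute_mat \<sigma> \<pi> = (\<chi> q l. \<pi> $ \<sigma> q $ \<sigma> l)"

definition max_norm :: "real ^ 'q ^ 'q \<Rightarrow> real" where
  "max_norm A = (MAX (q, l) \<in> UNIV. \<bar>A $ q $ l\<bar>)"

end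

theory Submission
  imports Defs
begin

text \<open>
  Compare the likelihoods of a parameter \<open>\<theta> = (\<Gamma>, \<pi>)\<close> and of the true parameter
  \<open>\<theta>\<^sub>0 = (\<Gamma>\<^sub>0, \<pi>\<^sub>0)\<close>. The law of the labels contributes little: a label array has probability
  at least \<open>\<delta>\<^bsup>n T\<^esup>\<close>, while the conditional log-likelihood of the graphs is a sum of
  order \<open>n\<^sup>2 T\<close>. Hence, up to an error of order \<open>n T\<close>, the log-likelihood of \<open>\<theta>\<close> is the maximum
  over label arrays \<open>z'\<close> of the conditional log-likelihood of the graphs (\<open>lik_ge\<close>, \<open>lik_le\<close>).

  The noise is controlled uniformly. For a fixed label array \<open>z'\<close> and a pair of classes, the sum of
  the centred edges of that type has sub-Gaussian tails with variance proxy of order \<open>n\<^sup>2 T\<close>, and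
  there are \<open>Q\<^bsup>n T\<^esup>\<close> label arrays. So all these sums are of order
  \<open>n\<^bsup>3/2\<^esup> T\<close>, except on an event of exponentially small probability
  (\<open>edge_noise_uniform_tail\<close>).

  Suppose that \<open>\<theta>\<close> is at least as likely as \<open>\<theta>\<^sub>0\<close>. Since the conditional relative entropy dominates
  half the squared distance of the edge probabilities, there is a label array \<open>z'\<close> such that the
  probabilities under \<open>(\<pi>, z')\<close> and \<open>(\<pi>\<^sub>0, z)\<close> differ, in total squared error, by a constant
  times \<open>n\<^bsup>3/2\<^esup> T\<close> (\<open>squared_error_le\<close>). At some time
  the error is at most the average over time. At that time every true class \<open>q\<close> has at least
  \<open>\<delta> n / 2\<close> nodes (\<open>class_sizes_concentrate\<close>; the union bound over the times is where
  \<open>log T = o(n)\<close> enters), and by the pigeonhole principle a fixed fraction of them gets one common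
  label \<open>f q\<close> from \<open>z'\<close>. The order of \<open>n\<^sup>2\<close> pairs of nodes which so represent a pair \<open>(q, l)\<close> of
  classes all incur the same squared error, and this bounds the distance of \<open>\<pi>\<^sub>0 q l\<close> from
  \<open>\<pi> (f q) (f l)\<close> by a constant times \<open>n\<^bsup>-1/4\<^esup>\<close>
  (\<open>one_graph_matching\<close>, \<open>likely_params_match\<close>). As the rows of \<open>\<pi>\<^sub>0\<close> are distinct, \<open>f\<close> is
  injective for large \<open>n\<close>, hence a permutation, and the rows of \<open>\<pi>\<close> are distinct too.

  The last remark also settles the existence of a maximiser. The likelihood attains its maximum over
  the compact set of parameters whose rows may coincide (\<open>lik_attains_max\<close>). This maximiser is at
  least as likely as \<open>\<theta>\<^sub>0\<close>, so its rows are distinct and it maximises over the parameter space itself;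
  then the estimator is such a maximiser, to which the argument above applies (\<open>mle_close\<close>).
\<close>


section \<open>The stationary distribution\<close>

lemma compact_prob_vectors: "compact {a :: real ^ 'q::finite. prob_vector a}"
proof -
  have "{a :: real ^ 'q. prob_vector a} = (\<Inter>q. {a. 0 \<le> a $ q}) \<inter> {a. (\<Sum>q\<in>UNIV. a $ q) = 1}"
    by (auto simp: prob_vector_def)
  moreover have "closed \<dots>"
    by (intro closed_Int closed_INT ballI closed_Collect_le closed_Collect_eq continuous_intros)
  moreover have "bounded {a :: real ^ 'q. prob_vector a}"
  proof (rule boundedI)
    fix a :: "real ^ 'q" assume "a \<in> {a. prob_vector a}"
    then show "norm a \<le> 1"
      using norm_le_l1_cart[of a] by (simp add: prob_vector_def)
  qed
  ultimately show ?thesis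
    by (simp add: compact_eq_bounded_closed)
qed

text \<open>Brouwer's fixed point theorem on the simplex.\<close>
lemma stationary_exists:
  fixes \<Gamma> :: "real ^ 'q ^ ('q::finite)"
  assumes "stochastic \<Gamma>"
  shows "\<exists>a. prob_vector a \<and> a v* \<Gamma> = a"
proof -
  let ?S = "{a :: real ^ 'q. prob_vector a}"
  have "convex ?S"
    unfolding convex_def
    by (auto simp: prob_vector_def sum.distrib simp flip: sum_distrib_left)
  moreover have "(\<chi> q. 1 / real CARD('q)) \<in> ?S"
    by (simp add: prob_vector_def)
  moreover have "continuous_on ?S (\<lambda>a. a v* \<Gamma>)"
    unfolding vector_matrix_mult_def by (intro continuous_on_vec_lambda continuous_intros)
  moreover have "a v* \<Gamma> \<in> ?S" if "a \<in> ?S" for a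
  proof -
    have a: "0 \<le> a $ q" "(\<Sum>q\<in>UNIV. a $ q) = 1" for q
      using that by (auto simp: prob_vector_def)
    have \<Gamma>: "0 \<le> \<Gamma> $ q $ l" "(\<Sum>l\<in>UNIV. \<Gamma> $ q $ l) = 1" for q l
      using assms by (auto simp: stochastic_def prob_vector_def)
    have "(\<Sum>l\<in>UNIV. \<Sum>q\<in>UNIV. \<Gamma> $ q $ l * a $ q) = (\<Sum>q\<in>UNIV. (\<Sum>l\<in>UNIV. \<Gamma> $ q $ l) * a $ q)"
      by (subst sum.swap) (simp add: sum_distrib_right)
    with a \<Gamma> show ?thesis
      by (auto simp: prob_vector_def vector_matrix_mult_def mult.commute intro!: sum_nonneg)
  qed
  ultimately obtain a where "a \<in> ?S" "a v* \<Gamma> = a"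
    using brouwer[OF compact_prob_vectors, of "\<lambda>a. a v* \<Gamma>"] by blast
  then show ?thesis by auto
qed

lemma stationary_ge:
  fixes \<Gamma> :: "real ^ 'q ^ ('q::finite)"
  assumes "prob_vector a" "a v* \<Gamma> = a" "\<And>q l. \<delta> \<le> \<Gamma> $ q $ l"
  shows "\<delta> \<le> a $ l"
proof -
  have "\<delta> = (\<Sum>q\<in>UNIV. \<delta> * a $ q)"
    using assms(1) by (simp add: prob_vector_def flip: sum_distrib_left)
  also have "\<dots> \<le> (\<Sum>q\<in>UNIV. \<Gamma> $ q $ l * a $ q)"
    using assms(1,3) by (intro sum_mono mult_right_mono) (auto simp: prob_vector_def)
  also have "\<dots> = a $ l"
    using arg_cong[OF assms(2), of "\<lambda>v. v $ l"] by (simp add: vector_matrix_mult_def mult.commute)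
  finally show ?thesis .
qed

text \<open>Subtracting \<open>\<delta>\<close> from all entries does not change the action of \<open>\<Gamma>\<close> on vectors
  with total mass \<open>0\<close>, and shows that this action contracts the \<open>1\<close>-norm by a factor of
  \<open>1 - Q \<delta>\<close> (Doeblin).\<close>
lemma stationary_unique:
  fixes \<Gamma> :: "real ^ 'q ^ ('q::finite)"
  assumes "stochastic \<Gamma>" "0 < \<delta>" "\<And>q l. \<delta> \<le> \<Gamma> $ q $ l"
    and a: "prob_vector a" "a v* \<Gamma> = a" and b: "prob_vector b" "b v* \<Gamma> = b"
  shows "a = b"
proof -
  define d where "d = a - b"
  define D where "D = (\<Sum>q\<in>UNIV. \<bar>d $ q\<bar>)"
  have sum0: "(\<Sum>q\<in>UNIV. d $ q) = 0"
    using a(1) b(1) by (simp add: d_def prob_vector_def sum_subtractf)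
  have d_eq: "d $ l = (\<Sum>q\<in>UNIV. (\<Gamma> $ q $ l - \<delta>) * d $ q)" for l
  proof -
    have "a $ l = (\<Sum>q\<in>UNIV. \<Gamma> $ q $ l * a $ q)" "b $ l = (\<Sum>q\<in>UNIV. \<Gamma> $ q $ l * b $ q)"
      using arg_cong[OF a(2), of "\<lambda>v. v $ l"] arg_cong[OF b(2), of "\<lambda>v. v $ l"]
      by (simp_all add: vector_matrix_mult_def mult.commute)
    then have "d $ l = (\<Sum>q\<in>UNIV. \<Gamma> $ q $ l * d $ q)"
      by (simp add: d_def algebra_simps sum_subtractf)
    then show ?thesis
      using sum0 by (simp add: algebra_simps sum_subtractf flip: sum_distrib_left)
  qed
  have "D \<le> (\<Sum>l\<in>UNIV. \<Sum>q\<in>UNIV. (\<Gamma> $ q $ l - \<delta>) * \<bar>d $ q\<bar>)"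
    unfolding D_def
  proof (rule sum_mono)
    fix l
    have "\<bar>d $ l\<bar> \<le> (\<Sum>q\<in>UNIV. \<bar>(\<Gamma> $ q $ l - \<delta>) * d $ q\<bar>)"
      by (subst d_eq) (rule sum_abs)
    also have "\<dots> = (\<Sum>q\<in>UNIV. (\<Gamma> $ q $ l - \<delta>) * \<bar>d $ q\<bar>)"
      using assms(3) by (simp add: abs_mult)
    finally show "\<bar>d $ l\<bar> \<le> \<dots>" .
  qed
  also have "\<dots> = (\<Sum>q\<in>UNIV. (\<Sum>l\<in>UNIV. \<Gamma> $ q $ l - \<delta>) * \<bar>d $ q\<bar>)"
    by (subst sum.swap) (simp add: sum_distrib_right)
  also have "\<dots> = (\<Sum>q\<in>UNIV. (1 - CARD('q) * \<delta>) * \<bar>d $ q\<bar>)"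
    using assms(1) by (simp add: stochastic_def prob_vector_def sum_subtractf)
  also have "\<dots> = (1 - CARD('q) * \<delta>) * D"
    by (simp add: D_def sum_distrib_left)
  finally have "CARD('q) * \<delta> * D \<le> 0"
    by (simp add: algebra_simps)
  then have "D \<le> 0"
    using \<open>0 < \<delta>\<close> by (simp add: mult_le_0_iff)
  then have "D = 0"
    unfolding D_def by (intro antisym sum_nonneg) auto
  then have "d $ q = 0" for q
    by (simp add: D_def sum_nonneg_eq_0_iff)
  then show ?thesis
    by (simp add: d_def vec_eq_iff)
qed

lemma stationary_dist_eqI:
  assumes "stochastic \<Gamma>" "0 < \<delta>" "\<And>q l. \<delta> \<le> \<Gamma> $ q $ l" "prob_vector a" "a v* \<Gamma> = a"
  shows "stationary_dist \<Gamma> = a"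
  unfolding stationary_dist_def
  by (rule the_equality) (use stationary_unique[OF assms(1-3)] assms(4,5) in auto)

lemma stationary_dist:
  assumes "stochastic \<Gamma>" "0 < \<delta>" "\<And>q l. \<delta> \<le> \<Gamma> $ q $ l"
  shows "prob_vector (stationary_dist \<Gamma>)" "stationary_dist \<Gamma> v* \<Gamma> = stationary_dist \<Gamma>"
proof -
  obtain a where "prob_vector a" "a v* \<Gamma> = a"
    using stationary_exists[OF assms(1)] by blast
  then show "prob_vector (stationary_dist \<Gamma>)" "stationary_dist \<Gamma> v* \<Gamma> = stationary_dist \<Gamma>"
    using stationary_dist_eqI[OF assms] by auto
qed


section \<open>The law of the labels\<close>

lemma pmf_vec_pmf: "prob_vector a \<Longrightarrow> pmf (vec_pmf a) q = a $ q"
  unfolding vec_pmf_def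
  by (rule pmf_embed_pmf)
    (auto simp: prob_vector_def nn_integral_count_space_finite sum_ennreal)

definition path_space :: "nat \<Rightarrow> (nat \<Rightarrow> 'q) set" where
  "path_space T = (\<Pi>\<^sub>E t\<in>{1..T}. UNIV)"

text \<open>The initial vector \<open>a\<close> is kept separate from \<open>\<Gamma>\<close>, so that a path weight is visibly a
  polynomial in the entries of \<open>a\<close> and \<open>\<Gamma>\<close>.\<close>
definition path_weight :: "real ^ 'q \<Rightarrow> real ^ 'q ^ 'q \<Rightarrow> nat \<Rightarrow> (nat \<Rightarrow> 'q) \<Rightarrow> real" where
  "path_weight a \<Gamma> T z = (\<Prod>t\<in>{1..T}. if t = 1 then a $ z 1 else \<Gamma> $ z (t - 1) $ z t)"

lemma card_path_space: "card (path_space T :: (nat \<Rightarrow> 'q::finite) set) = CARD('q) ^ T"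
  and finite_path_space: "finite (path_space T :: (nat \<Rightarrow> 'q::finite) set)"
  unfolding path_space_def by (auto simp: card_PiE intro: finite_PiE)

lemma set_chain_pmf: "set_pmf (chain_pmf \<Gamma> T) \<subseteq> path_space T"
proof (induction T)
  case (Suc T)
  show ?case
  proof
    fix z assume "z \<in> set_pmf (chain_pmf \<Gamma> (Suc T))"
    then obtain y q where "y \<in> set_pmf (chain_pmf \<Gamma> T)" "z = y(Suc T := q)"
      by auto
    with Suc show "z \<in> path_space (Suc T)"
      by (auto simp: path_space_def PiE_def extensional_def)
  qed
qed (simp add: path_space_def)

context
  fixes \<Gamma> :: "real ^ 'q ^ ('q::finite)" and \<delta> :: real
  assumes \<Gamma>: "stochastic \<Gamma>" "0 < \<delta>" "\<And>q l. \<delta> \<le> \<Gamma> $ q $ l"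
begin

lemma prob_vector_step: "prob_vector (if t = 0 then stationary_dist \<Gamma> else \<Gamma> $ z t)"
  using \<Gamma>(1) stationary_dist(1)[OF \<Gamma>] by (auto simp: stochastic_def)

lemma step_ge: "\<delta> \<le> (if t = 0 then stationary_dist \<Gamma> else \<Gamma> $ z t) $ q"
  using \<Gamma>(3) stationary_ge[OF stationary_dist[OF \<Gamma>] \<Gamma>(3)] by simp

lemma pmf_chain_pmf:
  assumes "z \<in> path_space T"
  shows "pmf (chain_pmf \<Gamma> T) z = path_weight (stationary_dist \<Gamma>) \<Gamma> T z"
  using assms
proof (induction T arbitrary: z)
  case 0
  then show ?case by (simp add: path_space_def path_weight_def)
next
  case (Suc T)
  define y\<^sub>0 where "y\<^sub>0 = z(Suc T := undefined)"
  let ?a = "\<lambda>y. if T = 0 then stationary_dist \<Gamma> else \<Gamma> $ y T"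
  have z: "y\<^sub>0 \<in> path_space T"
    using Suc.prems by (auto simp: y\<^sub>0_def path_space_def PiE_def extensional_def)
  have "pmf (map_pmf (\<lambda>q. y(Suc T := q)) (vec_pmf (?a y))) z =
      (if y = y\<^sub>0 then ?a z $ z (Suc T) else 0)" if y: "y \<in> path_space T" for y
  proof (cases "y = y\<^sub>0")
    case True
    have inj: "inj (\<lambda>q. y(Suc T := q))"
      by (rule injI) (metis fun_upd_same)
    have "z = y(Suc T := z (Suc T))"
      using True by (auto simp: y\<^sub>0_def)
    then have "pmf (map_pmf (\<lambda>q. y(Suc T := q)) (vec_pmf (?a y))) z = pmf (vec_pmf (?a y)) (z (Suc T))"
      using pmf_map_inj'[OF inj] by metis
    then show ?thesis
      using True pmf_vec_pmf[OF prob_vector_step[of T y]] by (auto simp: y\<^sub>0_def)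
  next
    case False
    have "y (Suc T) = undefined"
      using y by (auto simp: path_space_def PiE_def extensional_def)
    with False have "z \<notin> set_pmf (map_pmf (\<lambda>q. y(Suc T := q)) (vec_pmf (?a y)))"
      by (auto simp: y\<^sub>0_def)
    then show ?thesis
      using False by (simp add: pmf_eq_0_set_pmf)
  qed
  note step = this
  have "pmf (chain_pmf \<Gamma> (Suc T)) z =
      measure_pmf.expectation (chain_pmf \<Gamma> T) (\<lambda>y. if y = y\<^sub>0 then ?a z $ z (Suc T) else 0)"
    unfolding chain_pmf.simps pmf_bind map_pmf_def[symmetric]
  proof (intro integral_cong_AE)
    show "AE y in chain_pmf \<Gamma> T. pmf (map_pmf (\<lambda>q. y(Suc T := q)) (vec_pmf (?a y))) z =
        (if y = y\<^sub>0 then ?a z $ z (Suc T) else 0)"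
      unfolding AE_measure_pmf_iff using step set_chain_pmf by blast
  qed simp_all
  also have "\<dots> = (\<Sum>y\<in>{y\<^sub>0}. (if y = y\<^sub>0 then ?a z $ z (Suc T) else 0) * pmf (chain_pmf \<Gamma> T) y)"
    by (intro integral_measure_pmf_real) (auto split: if_splits)
  also have "\<dots> = path_weight (stationary_dist \<Gamma>) \<Gamma> T y\<^sub>0 * ?a z $ z (Suc T)"
    using Suc.IH[OF z] by simp
  also have "path_weight (stationary_dist \<Gamma>) \<Gamma> T y\<^sub>0 = path_weight (stationary_dist \<Gamma>) \<Gamma> T z"
    unfolding path_weight_def y\<^sub>0_def by (intro prod.cong) auto
  finally show ?case
    by (simp add: path_weight_def)
qed

lemma pmf_chain_pmf_ge:
  assumes "z \<in> path_space T"
  shows "\<delta> ^ T \<le> pmf (chain_pmf \<Gamma> T) z"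
proof -
  have "(\<Prod>t\<in>{1..T}. \<delta>) \<le> path_weight (stationary_dist \<Gamma>) \<Gamma> T z"
    unfolding path_weight_def
    using \<Gamma>(2,3) stationary_ge[OF stationary_dist[OF \<Gamma>] \<Gamma>(3)] by (intro prod_mono) auto
  then show ?thesis
    using pmf_chain_pmf[OF assms] by simp
qed

text \<open>Whatever the past of a node, its next class is \<open>q\<close> with probability at least \<open>\<delta>\<close>.\<close>
lemma chain_marginal_ge:
  assumes "t \<in> {1..T}"
  shows "\<delta> \<le> measure_pmf.prob (chain_pmf \<Gamma> T) {z. z t = q}"
  using assms
proof (induction T)
  case (Suc T)
  let ?a = "\<lambda>y. if T = 0 then stationary_dist \<Gamma> else \<Gamma> $ y T"
  have "map_pmf (\<lambda>z. z t) (chain_pmf \<Gamma> (Suc T)) =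
      (if t = Suc T then chain_pmf \<Gamma> T \<bind> (\<lambda>y. vec_pmf (?a y)) else map_pmf (\<lambda>z. z t) (chain_pmf \<Gamma> T))"
    unfolding chain_pmf.simps map_bind_pmf
    by (auto simp: map_pmf_def bind_assoc_pmf bind_return_pmf bind_return_pmf')
  moreover have "measure_pmf.prob M {z. z t = q} = pmf (map_pmf (\<lambda>z. z t) M) q" for M :: "(nat \<Rightarrow> 'q) pmf"
    by (simp add: pmf_map vimage_def)
  moreover have "\<delta> \<le> pmf (chain_pmf \<Gamma> T \<bind> (\<lambda>y. vec_pmf (?a y))) q"
    unfolding pmf_bind
  proof (rule measure_pmf.integral_ge_const)
    have "\<delta> \<le> pmf (vec_pmf (?a y)) q" for y
      by (subst pmf_vec_pmf[OF prob_vector_step]) (rule step_ge)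
    then show "AE y in chain_pmf \<Gamma> T. \<delta> \<le> pmf (vec_pmf (?a y)) q"
      by (rule AE_pmfI)
  qed (auto intro!: measure_pmf.integrable_const_bound[where B=1] simp: pmf_le_1)
  ultimately show ?case
    using Suc by (cases "t = Suc T") auto
qed simp

end


definition label_space :: "nat \<Rightarrow> nat \<Rightarrow> 'q labels set" where
  "label_space n T = PiE_dflt {1..n} (\<lambda>_. undefined) (\<lambda>_. path_space T)"

lemma finite_label_space: "finite (label_space n T :: ('q::finite) labels set)"
  unfolding label_space_def by (intro finite_PiE_dflt finite_path_space) auto

lemma card_label_space: "card (label_space n T :: ('q::finite) labels set) = CARD('q) ^ (T * n)"
  unfolding label_space_def
  by (subst card_PiE_dflt) (auto simp: finite_path_space card_path_space power_mult)

lemma set_labels_pmf: "set_pmf (labels_pmf \<Gamma> n T) \<subseteq> label_space n T"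
  unfolding labels_pmf_def label_space_def
  using set_chain_pmf[of \<Gamma> T] by (auto simp: set_Pi_pmf PiE_dflt_def)

lemma pmf_labels_pmf:
  assumes "z \<in> label_space n T"
  shows "pmf (labels_pmf \<Gamma> n T) z = (\<Prod>i\<in>{1..n}. pmf (chain_pmf \<Gamma> T) (z i))"
  unfolding labels_pmf_def
  using assms by (intro pmf_Pi') (auto simp: label_space_def PiE_dflt_def)

lemma pmf_labels_pmf_ge:
  assumes "stochastic \<Gamma>" "0 < \<delta>" "\<And>q l. \<delta> \<le> \<Gamma> $ q $ l" "z \<in> label_space n T"
  shows "\<delta> ^ (T * n) \<le> pmf (labels_pmf \<Gamma> n T) z"
proof -
  have "(\<Prod>i\<in>{1..n}. \<delta> ^ T) \<le> (\<Prod>i\<in>{1..n}. pmf (chain_pmf \<Gamma> T) (z i))"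
    using assms by (intro prod_mono conjI pmf_chain_pmf_ge[OF assms(1-3)])
      (auto simp: label_space_def PiE_dflt_def)
  then show ?thesis
    using pmf_labels_pmf[OF assms(4)] by (simp add: power_mult)
qed


section \<open>The likelihood\<close>

definition edge_lik :: "real \<Rightarrow> bool \<Rightarrow> real" where
  "edge_lik p b = (if b then p else 1 - p)"

definition graph_lik :: "real ^ 'q ^ 'q \<Rightarrow> nat \<Rightarrow> nat \<Rightarrow> 'q labels \<Rightarrow> graphs \<Rightarrow> real" where
  "graph_lik \<pi> n T z x = (\<Prod>(t, i, j)\<in>edge_index n T. edge_lik (\<pi> $ z i t $ z j t) (x t i j))"

definition symmetrise :: "(nat \<times> nat \<times> nat \<Rightarrow> bool) \<Rightarrow> graphs" where
  "symmetrise w = (\<lambda>t i j. w (t, min i j, max i j))"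

definition graph_space :: "nat \<Rightarrow> nat \<Rightarrow> graphs set" where
  "graph_space n T = symmetrise ` PiE_dflt (edge_index n T) False (\<lambda>_. UNIV)"

lemma finite_edge_index: "finite (edge_index n T)"
  by (rule finite_subset[of _ "{1..T} \<times> {1..n} \<times> {1..n}"]) (auto simp: edge_index_def)

lemma symmetrise_edge: "(t, i, j) \<in> edge_index n T \<Longrightarrow> symmetrise w t i j = w (t, i, j)"
  by (simp add: symmetrise_def edge_index_def)

lemma graphs_pmf_eq:
  "graphs_pmf \<pi> n T z =
     map_pmf symmetrise (Pi_pmf (edge_index n T) False (\<lambda>(t, i, j). bernoulli_pmf (\<pi> $ z i t $ z j t)))"
  by (simp add: graphs_pmf_def symmetrise_def[abs_def])

lemma set_graphs_pmf: "set_pmf (graphs_pmf \<pi> n T z) \<subseteq> graph_space n T"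
  unfolding graphs_pmf_eq graph_space_def set_map_pmf
  by (intro image_mono) (auto simp: set_Pi_pmf finite_edge_index PiE_dflt_def)

text \<open>Injectivity makes the probability of an observation a product over the edges.\<close>
lemma inj_on_symmetrise: "inj_on symmetrise (PiE_dflt (edge_index n T) False (\<lambda>_. UNIV))"
proof (rule inj_onI, rule ext)
  fix w w' :: "nat \<times> nat \<times> nat \<Rightarrow> bool" and e
  assume w: "w \<in> PiE_dflt (edge_index n T) False (\<lambda>_. UNIV)"
      "w' \<in> PiE_dflt (edge_index n T) False (\<lambda>_. UNIV)" and eq: "symmetrise w = symmetrise w'"
  show "w e = w' e"
  proof (cases "e \<in> edge_index n T")
    case True
    then show ?thesis
      using symmetrise_edge[of _ _ _ n T w] symmetrise_edge[of _ _ _ n T w'] eq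
      by (cases e) auto
  next
    case False
    then have "\<not> w e" "\<not> w' e"
      using w unfolding PiE_dflt_def by blast+
    then show ?thesis by simp
  qed
qed

lemma pmf_graphs_pmf:
  assumes x: "x \<in> graph_space n T" and \<pi>: "\<And>q l. \<pi> $ q $ l \<in> {\<zeta>..1 - \<zeta>}" and "0 < \<zeta>"
  shows "pmf (graphs_pmf \<pi> n T z) x = graph_lik \<pi> n T z x"
proof -
  let ?P = "Pi_pmf (edge_index n T) False (\<lambda>(t, i, j). bernoulli_pmf (\<pi> $ z i t $ z j t))"
  have \<pi>01: "0 < \<pi> $ q $ l" "\<pi> $ q $ l < 1" for q l
    using \<pi>[of q l] \<open>0 < \<zeta>\<close> by auto
  obtain w where w: "w \<in> PiE_dflt (edge_index n T) False (\<lambda>_. UNIV)" and xw: "x = symmetrise w"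
    using x by (auto simp: graph_space_def)
  have "set_pmf ?P = PiE_dflt (edge_index n T) False (\<lambda>_. UNIV)"
    using \<pi>01 by (auto simp: set_Pi_pmf finite_edge_index PiE_dflt_def set_pmf_bernoulli less_imp_le)
  with w have "pmf (graphs_pmf \<pi> n T z) x = pmf ?P w"
    unfolding graphs_pmf_eq xw using inj_on_symmetrise by (intro pmf_map_inj) auto
  also have "\<dots> = (\<Prod>(t, i, j)\<in>edge_index n T. pmf (bernoulli_pmf (\<pi> $ z i t $ z j t)) (w (t, i, j)))"
    using w by (subst pmf_Pi') (auto simp: finite_edge_index PiE_dflt_def split_def)
  also have "\<dots> = graph_lik \<pi> n T z x"
    unfolding graph_lik_def xw
    using \<pi>01 by (intro prod.cong) (auto simp: symmetrise_edge edge_lik_def less_imp_le)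
  finally show ?thesis .
qed

definition lik :: "nat \<Rightarrow> nat \<Rightarrow> graphs \<Rightarrow> ('q::finite) param \<Rightarrow> real" where
  "lik n T x \<theta> = measure_pmf.prob (dsbm_pmf \<theta> n T) {(z, x'). x' = x}"

lemma dsbm_pmf_eq:
  "dsbm_pmf \<theta> n T = labels_pmf (fst \<theta>) n T \<bind> (\<lambda>z. map_pmf (Pair z) (graphs_pmf (snd \<theta>) n T z))"
  by (simp add: dsbm_pmf_def map_pmf_def)

lemma lik_eq_sum:
  fixes \<theta> :: "('q::finite) param"
  shows "lik n T x \<theta> =
    (\<Sum>z\<in>label_space n T. pmf (labels_pmf (fst \<theta>) n T) z * pmf (graphs_pmf (snd \<theta>) n T z) x)"
proof -
  have "lik n T x \<theta> = pmf (map_pmf snd (dsbm_pmf \<theta> n T)) x"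
    by (auto simp: lik_def pmf_map vimage_def split_def)
  also have "map_pmf snd (dsbm_pmf \<theta> n T) =
      labels_pmf (fst \<theta>) n T \<bind> (\<lambda>z. graphs_pmf (snd \<theta>) n T z)"
    by (simp add: dsbm_pmf_eq map_bind_pmf map_pmf_comp)
  also have "pmf \<dots> x =
      (\<Sum>z\<in>label_space n T. pmf (graphs_pmf (snd \<theta>) n T z) x * pmf (labels_pmf (fst \<theta>) n T) z)"
    unfolding pmf_bind using set_labels_pmf
    by (intro integral_measure_pmf_real finite_label_space) auto
  finally show ?thesis by (simp add: mult.commute)
qed

text \<open>Dropping the open condition that the rows of \<open>\<pi>\<close> be distinct makes the set of parameters
  compact.\<close>
definition closed_param_space :: "real \<Rightarrow> real \<Rightarrow> ('q::finite) param set" where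
  "closed_param_space \<delta> \<zeta> = {(\<Gamma>, \<pi>). stochastic \<Gamma> \<and> transpose \<pi> = \<pi> \<and>
     (\<forall>q l. \<Gamma> $ q $ l \<in> {\<delta>..1 - \<delta>}) \<and> (\<forall>q l. \<pi> $ q $ l \<in> {\<zeta>..1 - \<zeta>})}"

definition distinct_rows :: "real ^ 'q ^ 'q \<Rightarrow> bool" where
  "distinct_rows \<pi> \<longleftrightarrow> (\<forall>q q'. q \<noteq> q' \<longrightarrow> (\<exists>l. \<pi> $ q $ l \<noteq> \<pi> $ q' $ l))"

lemma param_space_eq: "param_space \<delta> \<zeta> = {\<theta> \<in> closed_param_space \<delta> \<zeta>. distinct_rows (snd \<theta>)}"
  by (auto simp: param_space_def closed_param_space_def distinct_rows_def)

lemma closed_param_spaceD: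
  assumes "\<theta> \<in> closed_param_space \<delta> \<zeta>"
  shows "stochastic (fst \<theta>)" "\<And>q l. \<delta> \<le> fst \<theta> $ q $ l" "\<And>q l. snd \<theta> $ q $ l \<in> {\<zeta>..1 - \<zeta>}"
    "snd \<theta> $ q $ l = snd \<theta> $ l $ q"
  using assms by (auto simp: closed_param_space_def vec_eq_iff transpose_def)

lemma edge_lik_pos: "p \<in> {\<zeta>..1 - \<zeta>} \<Longrightarrow> 0 < \<zeta> \<Longrightarrow> 0 < edge_lik p b"
  by (auto simp: edge_lik_def)

lemma graph_lik_pos:
  assumes "\<And>q l. \<pi> $ q $ l \<in> {\<zeta>..1 - \<zeta>}" "0 < \<zeta>"
  shows "0 < graph_lik \<pi> n T z x"
  unfolding graph_lik_def using edge_lik_pos[OF assms(1) assms(2)]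
  by (auto intro!: prod_pos)

text \<open>One term of the sum over label arrays already gives the likelihood up to the factor
  \<open>\<delta>\<^bsup>T n\<^esup>\<close>, uniformly in the transition matrix.\<close>
lemma lik_ge:
  assumes "\<theta> \<in> closed_param_space \<delta> \<zeta>" "0 < \<delta>" "0 < \<zeta>" "x \<in> graph_space n T" "z \<in> label_space n T"
  shows "\<delta> ^ (T * n) * graph_lik (snd \<theta>) n T z x \<le> lik n T x \<theta>"
proof -
  note \<theta> = closed_param_spaceD[OF assms(1)]
  have "\<delta> ^ (T * n) * graph_lik (snd \<theta>) n T z x
      \<le> pmf (labels_pmf (fst \<theta>) n T) z * pmf (graphs_pmf (snd \<theta>) n T z) x"
    unfolding pmf_graphs_pmf[OF assms(4) \<theta>(3) assms(3)]
    using pmf_labels_pmf_ge[OF \<theta>(1) assms(2) \<theta>(2) assms(5)] graph_lik_pos[OF \<theta>(3) assms(3)]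
    by (intro mult_right_mono) (auto simp: less_imp_le)
  also have "\<dots> \<le> lik n T x \<theta>"
    unfolding lik_eq_sum using assms(5)
    by (intro member_le_sum[OF assms(5)] finite_label_space) auto
  finally show ?thesis .
qed

text \<open>An average over label arrays is at most its largest term.\<close>
lemma lik_le:
  fixes \<theta> :: "('q::finite) param"
  assumes "\<theta> \<in> closed_param_space \<delta> \<zeta>" "0 < \<zeta>" "x \<in> graph_space n T"
  shows "\<exists>z\<in>label_space n T. lik n T x \<theta> \<le> graph_lik (snd \<theta>) n T z x"
proof -
  note \<theta> = closed_param_spaceD[OF assms(1)]
  define f where "f z = graph_lik (snd \<theta>) n T z x" for z
  let ?S = "label_space n T :: 'q labels set"
  have ne: "?S \<noteq> {}"
    using set_labels_pmf[of "fst \<theta>" n T] set_pmf_not_empty[of "labels_pmf (fst \<theta>) n T"] by auto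
  have "Max (f ` ?S) \<in> f ` ?S"
    using ne finite_label_space by (intro Max_in) auto
  then obtain z where "z \<in> ?S" "Max (f ` ?S) = f z"
    by auto
  then have z: "z \<in> ?S" "\<And>y. y \<in> ?S \<Longrightarrow> f y \<le> f z"
    using Max_ge[of "f ` ?S"] finite_label_space[of n T] by auto
  have "lik n T x \<theta> = (\<Sum>y\<in>?S. pmf (labels_pmf (fst \<theta>) n T) y * f y)"
    unfolding lik_eq_sum f_def pmf_graphs_pmf[OF assms(3) \<theta>(3) assms(2)] ..
  also have "\<dots> \<le> (\<Sum>y\<in>?S. pmf (labels_pmf (fst \<theta>) n T) y * f z)"
    using z by (intro sum_mono mult_left_mono) auto
  also have "\<dots> = f z"
    using sum_pmf_eq_1[OF finite_label_space set_labels_pmf[of "fst \<theta>" n T]]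
    by (simp flip: sum_distrib_right)
  finally show ?thesis
    using z(1) by (auto simp: f_def)
qed

lemma lik_pos:
  fixes \<theta> :: "('q::finite) param"
  assumes "\<theta> \<in> closed_param_space \<delta> \<zeta>" "0 < \<delta>" "0 < \<zeta>" "x \<in> graph_space n T"
  shows "0 < lik n T x \<theta>"
proof -
  obtain z :: "'q labels" where z: "z \<in> label_space n T"
    using lik_le[OF assms(1,3,4)] by blast
  have "0 < \<delta> ^ (T * n) * graph_lik (snd \<theta>) n T z x"
    using graph_lik_pos[OF closed_param_spaceD(3)[OF assms(1)] assms(3)] assms(2) by simp
  with lik_ge[OF assms z] show ?thesis by linarith
qed

lemma bounded_matrices: "bounded {A :: real ^ 'q ^ ('q::finite). \<forall>q l. \<bar>A $ q $ l\<bar> \<le> c}"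
proof (rule boundedI)
  fix A :: "real ^ 'q ^ 'q" assume A: "A \<in> {A. \<forall>q l. \<bar>A $ q $ l\<bar> \<le> c}"
  have "norm A \<le> (\<Sum>q\<in>UNIV. norm (A $ q))"
    by (simp add: norm_vec_def L2_set_le_sum)
  also have "\<dots> \<le> (\<Sum>q\<in>UNIV. \<Sum>l\<in>UNIV. \<bar>A $ q $ l\<bar>)"
    by (intro sum_mono norm_le_l1_cart)
  also have "\<dots> \<le> (\<Sum>q\<in>(UNIV :: 'q set). \<Sum>l\<in>(UNIV :: 'q set). c)"
    using A by (intro sum_mono) auto
  finally show "norm A \<le> (\<Sum>q\<in>(UNIV :: 'q set). \<Sum>l\<in>(UNIV :: 'q set). c)" .
qed

text \<open>The likelihood is a polynomial in the entries of \<open>\<Gamma>\<close>, \<open>\<pi>\<close> and the stationary vector \<open>a\<close>.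
  Stationarity is a closed condition on the pair \<open>(a, \<Gamma>)\<close>, so the triples \<open>(a, \<Gamma>, \<pi>)\<close> form a
  compact set, and uniqueness of \<open>a\<close> turns a maximum over triples into a maximum over
  parameters.\<close>
lemma lik_attains_max:
  fixes \<theta>\<^sub>0 :: "('q::finite) param"
  assumes "\<theta>\<^sub>0 \<in> closed_param_space \<delta> \<zeta>" "0 < \<delta>" "0 < \<zeta>" "x \<in> graph_space n T"
  shows "\<exists>\<theta> \<in> closed_param_space \<delta> \<zeta> :: 'q param set.
    \<forall>\<theta>' \<in> closed_param_space \<delta> \<zeta> :: 'q param set. lik n T x \<theta>' \<le> lik n T x \<theta>"
proof -
  define S where "S = {p :: (real ^ 'q) \<times> 'q param.
    prob_vector (fst p) \<and> fst p v* fst (snd p) = fst p \<and> snd p \<in> closed_param_space \<delta> \<zeta>}"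
  define f where "f p = (\<Sum>z\<in>label_space n T.
    (\<Prod>i\<in>{1..n}. path_weight (fst p) (fst (snd p)) T (z i)) * graph_lik (snd (snd p)) n T z x)"
    for p :: "(real ^ 'q) \<times> 'q param"
  have f_eq: "f (stationary_dist (fst \<theta>), \<theta>) = lik n T x \<theta>"
    if "\<theta> \<in> closed_param_space \<delta> \<zeta>" for \<theta>
  proof -
    note \<theta> = closed_param_spaceD[OF that]
    have "(\<Prod>i\<in>{1..n}. path_weight (stationary_dist (fst \<theta>)) (fst \<theta>) T (z i)) =
        pmf (labels_pmf (fst \<theta>) n T) z" if z: "z \<in> label_space n T" for z
      unfolding pmf_labels_pmf[OF z] using z
      by (intro prod.cong refl pmf_chain_pmf[OF \<theta>(1) assms(2) \<theta>(2), symmetric])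
        (auto simp: label_space_def PiE_dflt_def)
    then show ?thesis
      unfolding f_def lik_eq_sum pmf_graphs_pmf[OF assms(4) \<theta>(3) assms(3)] by simp
  qed
  have S_stat: "stationary_dist (fst (snd p)) = fst p" if "p \<in> S" for p
  proof -
    have p: "prob_vector (fst p)" "fst p v* fst (snd p) = fst p" "snd p \<in> closed_param_space \<delta> \<zeta>"
      using that by (auto simp: S_def)
    show ?thesis
      by (rule stationary_dist_eqI[OF closed_param_spaceD(1)[OF p(3)] assms(2) closed_param_spaceD(2)[OF p(3)] p(1,2)])
  qed
  have S_mem: "(stationary_dist (fst \<theta>), \<theta>) \<in> S" if "\<theta> \<in> closed_param_space \<delta> \<zeta>" for \<theta>
    using that stationary_dist[OF closed_param_spaceD(1)[OF that] assms(2) closed_param_spaceD(2)[OF that]]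
    by (simp add: S_def)
  have "compact S"
  proof -
    let ?M = "{A :: real ^ 'q ^ 'q. \<forall>q l. \<bar>A $ q $ l\<bar> \<le> \<bar>\<delta>\<bar> + \<bar>\<zeta>\<bar> + 1}"
    have "S \<subseteq> {a. prob_vector a} \<times> ?M \<times> ?M"
    proof
      fix p assume "p \<in> S"
      then have "prob_vector (fst p)" and *: "snd p \<in> closed_param_space \<delta> \<zeta>"
        by (auto simp: S_def)
      moreover have "\<bar>fst (snd p) $ q $ l\<bar> \<le> \<bar>\<delta>\<bar> + \<bar>\<zeta>\<bar> + 1" "\<bar>snd (snd p) $ q $ l\<bar> \<le> \<bar>\<delta>\<bar> + \<bar>\<zeta>\<bar> + 1" for q l
      proof -
        have "fst (snd p) $ q $ l \<in> {\<delta>..1 - \<delta>}" "snd (snd p) $ q $ l \<in> {\<zeta>..1 - \<zeta>}"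
          using * by (auto simp: closed_param_space_def)
        then show "\<bar>fst (snd p) $ q $ l\<bar> \<le> \<bar>\<delta>\<bar> + \<bar>\<zeta>\<bar> + 1" "\<bar>snd (snd p) $ q $ l\<bar> \<le> \<bar>\<delta>\<bar> + \<bar>\<zeta>\<bar> + 1"
          by auto
      qed
      ultimately show "p \<in> {a. prob_vector a} \<times> ?M \<times> ?M"
        by (simp add: mem_Times_iff)
    qed
    moreover have "bounded ({a :: real ^ 'q. prob_vector a} \<times> ?M \<times> ?M)"
      using compact_prob_vectors by (intro bounded_Times bounded_matrices compact_imp_bounded)
    ultimately have "bounded S"
      by (rule bounded_subset[rotated])
    have stat_iff: "a v* \<Gamma> = a \<longleftrightarrow> (\<forall>l. (\<Sum>q\<in>UNIV. \<Gamma> $ q $ l * a $ q) = a $ l)"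
      for a :: "real ^ 'q" and \<Gamma> :: "real ^ 'q ^ 'q"
      by (simp add: vec_eq_iff vector_matrix_mult_def mult.commute)
    have symm_iff: "transpose \<pi> = \<pi> \<longleftrightarrow> (\<forall>q l. \<pi> $ l $ q = \<pi> $ q $ l)" for \<pi> :: "real ^ 'q ^ 'q"
      by (simp add: vec_eq_iff transpose_def)
    have "S = {p. (\<forall>q. 0 \<le> fst p $ q) \<and> (\<Sum>q\<in>UNIV. fst p $ q) = 1 \<and>
        (\<forall>l. (\<Sum>q\<in>UNIV. fst (snd p) $ q $ l * fst p $ q) = fst p $ l) \<and>
        (\<forall>q l. 0 \<le> fst (snd p) $ q $ l) \<and> (\<forall>q. (\<Sum>l\<in>UNIV. fst (snd p) $ q $ l) = 1) \<and>
        (\<forall>q l. snd (snd p) $ l $ q = snd (snd p) $ q $ l) \<and>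
        (\<forall>q l. \<delta> \<le> fst (snd p) $ q $ l) \<and> (\<forall>q l. fst (snd p) $ q $ l \<le> 1 - \<delta>) \<and>
        (\<forall>q l. \<zeta> \<le> snd (snd p) $ q $ l) \<and> (\<forall>q l. snd (snd p) $ q $ l \<le> 1 - \<zeta>)}"
      unfolding S_def closed_param_space_def split_def mem_Collect_eq stat_iff symm_iff
        prob_vector_def stochastic_def atLeastAtMost_iff
      by (rule Collect_cong) blast
    also have "closed \<dots>"
      by (intro closed_Collect_conj closed_Collect_all closed_Collect_le closed_Collect_eq continuous_intros)
    finally show ?thesis
      using \<open>bounded S\<close> by (simp add: compact_eq_bounded_closed)
  qed
  moreover have "S \<noteq> {}"
    using S_mem[OF assms(1)] by blast
  moreover have "continuous_on S f"
  proof -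
    have "continuous_on S (\<lambda>p. path_weight (fst p) (fst (snd p)) T y)" for y
      unfolding path_weight_def
    proof (rule continuous_on_prod)
      fix t show "continuous_on S (\<lambda>p. if t = 1 then fst p $ y 1 else fst (snd p) $ y (t - 1) $ y t)"
        by (cases "t = 1") (auto intro!: continuous_intros)
    qed
    moreover have "continuous_on S (\<lambda>p. graph_lik (snd (snd p)) n T z x)" for z
      unfolding graph_lik_def split_def
    proof (rule continuous_on_prod)
      fix e show "continuous_on S (\<lambda>p. edge_lik (snd (snd p) $ z (fst (snd e)) (fst e) $ z (snd (snd e)) (fst e))
          (x (fst e) (fst (snd e)) (snd (snd e))))"
        by (cases "x (fst e) (fst (snd e)) (snd (snd e))") (auto simp: edge_lik_def intro!: continuous_intros)
    qed
    ultimately show ?thesis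
      unfolding f_def by (intro continuous_intros)
  qed
  ultimately obtain p where p: "p \<in> S" "\<And>p'. p' \<in> S \<Longrightarrow> f p' \<le> f p"
    using continuous_attains_sup[of S f] by blast
  have mem: "snd p \<in> closed_param_space \<delta> \<zeta>"
    using p(1) by (simp add: S_def)
  have "lik n T x \<theta>' \<le> lik n T x (snd p)" if "\<theta>' \<in> closed_param_space \<delta> \<zeta>" for \<theta>' :: "'q param"
    using p(2)[OF S_mem[OF that]] f_eq[OF that] f_eq[OF mem] S_stat[OF p(1)] by simp
  with mem show ?thesis by blast
qed


section \<open>Concentration\<close>

lemma Hoeffding_Pi_pmf:
  fixes p :: "'i \<Rightarrow> 'b pmf" and f :: "'i \<Rightarrow> 'b \<Rightarrow> real"
  assumes "finite I" "A \<subseteq> I" "A \<noteq> {}" "\<And>i y. 0 \<le> f i y \<and> f i y \<le> 1" "0 \<le> s"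
  defines "\<mu> \<equiv> \<Sum>i\<in>A. measure_pmf.expectation (p i) (f i)"
  shows "measure_pmf.prob (Pi_pmf I d p) {w. (\<Sum>i\<in>A. f i (w i)) \<le> \<mu> - s} \<le> exp (- 2 * s\<^sup>2 / card A)"
    and "measure_pmf.prob (Pi_pmf I d p) {w. \<bar>(\<Sum>i\<in>A. f i (w i)) - \<mu>\<bar> \<ge> s} \<le> 2 * exp (- 2 * s\<^sup>2 / card A)"
proof -
  let ?M = "measure_pmf (Pi_pmf I d p)"
  have fin: "finite A"
    using assms(1,2) by (rule finite_subset[rotated])
  have "prob_space.indep_vars ?M (\<lambda>_. count_space UNIV) (\<lambda>i w. w i) A"
    using indep_vars_Pi_pmf[OF assms(1), of d p] assms(2)
    unfolding prob_space.indep_vars_def2[OF measure_pmf.prob_space_axioms]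
    by (auto intro: prob_space.indep_sets_mono_index[OF measure_pmf.prob_space_axioms])
  then have indep: "prob_space.indep_vars ?M (\<lambda>_. borel) (\<lambda>i w. f i (w i)) A"
    by (rule prob_space.indep_vars_compose2[OF measure_pmf.prob_space_axioms]) auto
  have mean: "measure_pmf.expectation (Pi_pmf I d p) (\<lambda>w. f i (w i)) = measure_pmf.expectation (p i) (f i)"
    if "i \<in> A" for i
  proof -
    have "measure_pmf.expectation (Pi_pmf I d p) (\<lambda>w. f i (w i)) =
        measure_pmf.expectation (map_pmf (\<lambda>w. w i) (Pi_pmf I d p)) (f i)"
      by simp
    also have "map_pmf (\<lambda>w. w i) (Pi_pmf I d p) = p i"
      using that assms(1,2) by (auto simp: Pi_pmf_component)
    finally show ?thesis .
  qed
  interpret Hoeffding_ineq ?M A "\<lambda>i w. f i (w i)" "\<lambda>_. 0" "\<lambda>_. 1" \<mu>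
    by unfold_locales (use fin indep assms(4) mean in \<open>auto simp: \<mu>_def\<close>)
  have pos: "(\<Sum>i\<in>A. (1 - 0 :: real)\<^sup>2) > 0"
    using fin assms(3) by (simp add: card_gt_0_iff)
  show "measure_pmf.prob (Pi_pmf I d p) {w. (\<Sum>i\<in>A. f i (w i)) \<le> \<mu> - s} \<le> exp (- 2 * s\<^sup>2 / card A)"
    using Hoeffding_ineq_le[OF assms(5) pos] by simp
  show "measure_pmf.prob (Pi_pmf I d p) {w. \<bar>(\<Sum>i\<in>A. f i (w i)) - \<mu>\<bar> \<ge> s} \<le> 2 * exp (- 2 * s\<^sup>2 / card A)"
    using Hoeffding_ineq_abs_ge[OF assms(5) pos] by simp
qed

text \<open>At a fixed time the nodes are independent and each has class \<open>q\<close> with probability at least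
  \<open>\<delta>\<close>, so Hoeffding's inequality applies with deviation \<open>\<delta> n / 2\<close> from the mean.\<close>
lemma class_sizes_concentrate:
  fixes \<Gamma> :: "real ^ 'q ^ ('q::finite)"
  assumes \<Gamma>: "stochastic \<Gamma>" "0 < \<delta>" "\<And>q l. \<delta> \<le> \<Gamma> $ q $ l" and "n \<ge> 1"
  shows "measure_pmf.prob (labels_pmf \<Gamma> n T)
      {z. \<exists>t\<in>{1..T}. \<exists>q. real (card {i\<in>{1..n}. z i t = q}) < \<delta> * n / 2}
    \<le> real T * CARD('q) * exp (- \<delta>\<^sup>2 * n / 2)"
proof -
  define B where "B = (\<lambda>(t, q). {z :: 'q labels. real (card {i\<in>{1..n}. z i t = q}) < \<delta> * n / 2})"
  have B: "measure_pmf.prob (labels_pmf \<Gamma> n T) (B (t, q)) \<le> exp (- \<delta>\<^sup>2 * n / 2)"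
    if t: "t \<in> {1..T}" for t q
  proof -
    let ?f = "\<lambda>(_ :: nat) (y :: nat \<Rightarrow> 'q). of_bool (y t = q) :: real"
    let ?\<mu> = "\<Sum>i\<in>{1..n}. measure_pmf.expectation (chain_pmf \<Gamma> T) (?f i)"
    have "measure_pmf.expectation (chain_pmf \<Gamma> T) (?f i) = measure_pmf.prob (chain_pmf \<Gamma> T) {y. y t = q}" for i :: nat
    proof -
      have "?f i = indicator {y. y t = q}"
        by (auto simp: indicator_def)
      then show ?thesis by simp
    qed
    then have "?\<mu> \<ge> n * \<delta>"
      using chain_marginal_ge[OF \<Gamma> t, of q] by (simp add: mult_left_mono)
    moreover have "(\<Sum>i\<in>{1..n}. ?f i (z i)) = real (card {i\<in>{1..n}. z i t = q})" for z
      by (simp add: Int_def)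
    ultimately have "B (t, q) \<subseteq> {z. (\<Sum>i\<in>{1..n}. ?f i (z i)) \<le> ?\<mu> - \<delta> * n / 2}"
      unfolding B_def prod.case by (intro Collect_mono impI) (simp only: mult.commute[of \<delta>])
    then have "measure_pmf.prob (labels_pmf \<Gamma> n T) (B (t, q)) \<le>
        measure_pmf.prob (labels_pmf \<Gamma> n T) {z. (\<Sum>i\<in>{1..n}. ?f i (z i)) \<le> ?\<mu> - \<delta> * n / 2}"
      by (intro measure_pmf.finite_measure_mono) auto
    also have "\<dots> \<le> exp (- 2 * (\<delta> * n / 2)\<^sup>2 / card {1..n})"
      unfolding labels_pmf_def using assms
      by (intro Hoeffding_Pi_pmf(1)) auto
    also have "- 2 * (\<delta> * n / 2)\<^sup>2 / card {1..n} = - \<delta>\<^sup>2 * n / 2"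
      using \<open>n \<ge> 1\<close> by (simp add: power2_eq_square field_simps)
    finally show ?thesis .
  qed
  have "{z. \<exists>t\<in>{1..T}. \<exists>q. real (card {i\<in>{1..n}. z i t = q}) < \<delta> * n / 2} = (\<Union>c\<in>{1..T} \<times> UNIV. B c)"
    by (auto simp: B_def)
  also have "measure_pmf.prob (labels_pmf \<Gamma> n T) \<dots> \<le>
      (\<Sum>c\<in>{1..T} \<times> UNIV. measure_pmf.prob (labels_pmf \<Gamma> n T) (B c))"
    by (intro measure_pmf.finite_measure_subadditive_finite) auto
  also have "\<dots> \<le> (\<Sum>c\<in>{1..T} \<times> (UNIV :: 'q set). exp (- \<delta>\<^sup>2 * n / 2))"
    using B by (intro sum_mono) auto
  finally show ?thesis
    by (simp add: card_cartesian_product)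
qed

text \<open>Types are taken with respect to arbitrary label arrays, whereas \<open>edge_noise\<close> is centred with
  the labels from which the graphs are drawn.\<close>
definition edges_of_type :: "nat \<Rightarrow> nat \<Rightarrow> 'q labels \<Rightarrow> 'q \<Rightarrow> 'q \<Rightarrow> (nat \<times> nat \<times> nat) set" where
  "edges_of_type n T z a b = {(t, i, j) \<in> edge_index n T. z i t = a \<and> z j t = b}"

definition edge_noise :: "real ^ 'q ^ 'q \<Rightarrow> 'q labels \<Rightarrow> graphs \<Rightarrow> nat \<times> nat \<times> nat \<Rightarrow> real" where
  "edge_noise \<pi> z x = (\<lambda>(t, i, j). of_bool (x t i j) - \<pi> $ z i t $ z j t)"

lemma card_edge_index_le: "card (edge_index n T) \<le> n\<^sup>2 * T"
proof -
  have "card (edge_index n T) \<le> card ({1..T} \<times> {1..n} \<times> {1..n})"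
    by (intro card_mono) (auto simp: edge_index_def)
  then show ?thesis by (simp add: card_cartesian_product power2_eq_square mult_ac)
qed

lemma edge_noise_tail:
  fixes \<pi> :: "real ^ 'q ^ ('q::finite)"
  assumes \<pi>: "\<And>q l. \<pi> $ q $ l \<in> {0..1}" and "0 < s" "A \<subseteq> edge_index n T" "n \<ge> 1" "T \<ge> 1"
  shows "measure_pmf.prob (graphs_pmf \<pi> n T z) {x. s \<le> \<bar>\<Sum>e\<in>A. edge_noise \<pi> z x e\<bar>}
    \<le> 2 * exp (- 2 * s\<^sup>2 / (real n ^ 2 * T))"
proof (cases "A = {}")
  case True
  then show ?thesis using \<open>0 < s\<close> by simp
next
  case False
  let ?p = "\<lambda>(t, i, j). bernoulli_pmf (\<pi> $ z i t $ z j t)"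
  let ?f = "\<lambda>(_ :: nat \<times> nat \<times> nat) b. of_bool b :: real"
  have fin: "finite A"
    using assms(3) finite_edge_index by (rule finite_subset)
  have mean: "measure_pmf.expectation (?p e) (?f e) = (case e of (t, i, j) \<Rightarrow> \<pi> $ z i t $ z j t)" for e
    using \<pi> by (cases e) auto
  have noise: "(\<Sum>e\<in>A. edge_noise \<pi> z (symmetrise w) e) =
      (\<Sum>e\<in>A. ?f e (w e)) - (\<Sum>e\<in>A. measure_pmf.expectation (?p e) (?f e))" for w
    unfolding mean sum_subtractf[symmetric] edge_noise_def
    using assms(3) by (intro sum.cong) (auto simp: symmetrise_edge)
  have "measure_pmf.prob (graphs_pmf \<pi> n T z) {x. s \<le> \<bar>\<Sum>e\<in>A. edge_noise \<pi> z x e\<bar>} \<le> 2 * exp (- 2 * s\<^sup>2 / card A)"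
    unfolding graphs_pmf_eq measure_map_pmf vimage_def mem_Collect_eq noise
    using assms False by (intro Hoeffding_Pi_pmf(2) finite_edge_index) auto
  also have "\<dots> \<le> 2 * exp (- 2 * s\<^sup>2 / (real n ^ 2 * T))"
  proof -
    have "card A \<le> n\<^sup>2 * T"
      using card_mono[OF finite_edge_index assms(3)] card_edge_index_le le_trans by blast
    then have "real (card A) \<le> real n ^ 2 * T"
      by (metis of_nat_le_iff of_nat_mult of_nat_power)
    moreover have "0 < real (card A)"
      using fin False by (simp add: card_gt_0_iff)
    ultimately show ?thesis
      by (simp add: frac_le)
  qed
  finally show ?thesis .
qed

text \<open>At the level \<open>Q n\<^bsup>3/2\<^esup> T\<close> the Gaussian exponent is \<open>2 Q\<^sup>2 n T\<close>, which exceeds the entropy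
  \<open>n T ln Q \<le> Q n T\<close> of the set of label arrays by at least \<open>n\<close>.\<close>
lemma edge_noise_uniform_tail:
  fixes \<pi> :: "real ^ 'q ^ ('q::finite)"
  assumes \<pi>: "\<And>q l. \<pi> $ q $ l \<in> {0..1}" and "n \<ge> 1" "T \<ge> 1"
  shows "measure_pmf.prob (graphs_pmf \<pi> n T z)
      {x. \<exists>z'\<in>label_space n T :: 'q labels set. \<exists>a b.
         CARD('q) * real n powr (3 / 2) * T \<le> \<bar>\<Sum>e\<in>edges_of_type n T z' a b. edge_noise \<pi> z x e\<bar>}
    \<le> 2 * CARD('q) ^ 2 * exp (- real n)"
proof -
  define s where "s = CARD('q) * real n powr (3 / 2) * T"
  define B where "B = (\<lambda>(z' :: 'q labels, a, b). {x. s \<le> \<bar>\<Sum>e\<in>edges_of_type n T z' a b. edge_noise \<pi> z x e\<bar>})"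
  define I :: "('q labels \<times> 'q \<times> 'q) set" where "I = label_space n T \<times> UNIV \<times> UNIV"
  let ?Q = "real CARD('q)"
  have "0 < s"
    using assms(2,3) by (simp add: s_def)
  have "(real n powr (3 / 2))\<^sup>2 = real n ^ 3"
    using assms(2) by (simp add: powr_power powr_realpow)
  then have s2: "2 * s\<^sup>2 / (real n ^ 2 * T) = 2 * ?Q\<^sup>2 * (n * T)"
    using assms(2,3) by (simp add: s_def power_mult_distrib power2_eq_square power3_eq_cube field_simps)
  have Q: "1 \<le> ?Q"
    by (metis Suc_leI One_nat_def of_nat_1 of_nat_le_iff zero_less_card_finite)
  have "measure_pmf.prob (graphs_pmf \<pi> n T z)
      {x. \<exists>z'\<in>label_space n T :: 'q labels set. \<exists>a b. s \<le> \<bar>\<Sum>e\<in>edges_of_type n T z' a b. edge_noise \<pi> z x e\<bar>}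
      = measure_pmf.prob (graphs_pmf \<pi> n T z) (\<Union>c\<in>I. B c)"
    by (intro arg_cong[where f="measure_pmf.prob _"]) (auto simp: B_def I_def)
  also have "\<dots> \<le> (\<Sum>c\<in>I. measure_pmf.prob (graphs_pmf \<pi> n T z) (B c))"
    unfolding I_def by (intro measure_pmf.finite_measure_subadditive_finite) (auto intro: finite_label_space)
  also have "\<dots> \<le> (\<Sum>c\<in>I. 2 * exp (- 2 * s\<^sup>2 / (real n ^ 2 * T)))"
  proof (rule sum_mono)
    fix c assume "c \<in> I"
    obtain z' a b where c: "c = (z', a, b)"
      by (cases c)
    have "edges_of_type n T z' a b \<subseteq> edge_index n T"
      by (auto simp: edges_of_type_def)
    then show "measure_pmf.prob (graphs_pmf \<pi> n T z) (B c) \<le> 2 * exp (- 2 * s\<^sup>2 / (real n ^ 2 * T))"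
      unfolding B_def c prod.case by (intro edge_noise_tail[OF \<pi> \<open>0 < s\<close>] assms)
  qed
  also have "\<dots> = ?Q ^ (T * n) * (?Q\<^sup>2 * (2 * exp (- (2 * ?Q\<^sup>2 * (n * T)))))"
    using s2 by (simp add: I_def card_cartesian_product card_label_space power2_eq_square)
  also have "?Q ^ (T * n) \<le> exp (?Q * (n * T))"
  proof -
    have "?Q \<le> exp ?Q"
      using exp_ge_add_one_self[of ?Q] by linarith
    then have "?Q ^ (T * n) \<le> exp ?Q ^ (T * n)"
      by (intro power_mono) auto
    then show ?thesis
      by (simp add: mult_ac flip: exp_of_nat_mult)
  qed
  also have "exp (?Q * (n * T)) * (?Q\<^sup>2 * (2 * exp (- (2 * ?Q\<^sup>2 * (n * T))))) =
      2 * ?Q\<^sup>2 * exp ((?Q - 2 * ?Q\<^sup>2) * (n * T))"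
    by (simp add: algebra_simps flip: exp_add)
  also have "\<dots> \<le> 2 * ?Q\<^sup>2 * exp (- real n)"
  proof -
    have "?Q * 1 \<le> ?Q * ?Q"
      using Q by (intro mult_left_mono) auto
    then have "?Q - 2 * ?Q\<^sup>2 \<le> - 1"
      using Q unfolding power2_eq_square by linarith
    then have "(?Q - 2 * ?Q\<^sup>2) * (n * T) \<le> - 1 * real (n * T)"
      by (intro mult_right_mono) auto
    also have "\<dots> \<le> - real n"
      using assms(3) mult_left_mono[of 1 "real T" "real n"] by simp
    finally show ?thesis by (intro mult_left_mono) auto
  qed
  finally show ?thesis
    by (simp add: s_def)
qed

lemma prob_bind_pmf_le:
  assumes "\<And>y. measure_pmf.prob (f y) X \<le> c"
  shows "measure_pmf.prob (bind_pmf M f) X \<le> c"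
proof -
  have "0 \<le> c"
    using assms measure_nonneg order_trans by blast
  have "emeasure (bind_pmf M f) X \<le> (\<integral>\<^sup>+y. ennreal c \<partial>M)"
    unfolding emeasure_bind_pmf using assms
    by (intro nn_integral_mono) (simp add: measure_pmf.emeasure_eq_measure ennreal_leI)
  then show ?thesis
    using \<open>0 \<le> c\<close> by (simp add: measure_pmf.emeasure_eq_measure)
qed


section \<open>From likelihood to squared error\<close>

lemma ln_le_sqrt: "0 < u \<Longrightarrow> ln u \<le> 2 * (sqrt u - 1)" for u :: real
  using ln_le_minus_one[of "sqrt u"] by (simp add: ln_sqrt)

lemma sqrt_diff_square_ge:
  fixes p q :: real
  assumes "0 \<le> p" "p \<le> 1" "0 \<le> q" "q \<le> 1"
  shows "(p - q)\<^sup>2 / 4 \<le> (sqrt p - sqrt q)\<^sup>2"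
proof -
  have "(p - q)\<^sup>2 = (sqrt p - sqrt q)\<^sup>2 * (sqrt p + sqrt q)\<^sup>2"
    using assms by (simp add: algebra_simps flip: power_mult_distrib)
  also have "\<dots> \<le> (sqrt p - sqrt q)\<^sup>2 * 2\<^sup>2"
  proof (intro mult_left_mono power_mono)
    show "sqrt p + sqrt q \<le> 2"
      using assms real_sqrt_le_1_iff[of p] real_sqrt_le_1_iff[of q] by linarith
  qed (use assms in auto)
  finally show ?thesis by simp
qed

text \<open>A form of Pinsker's inequality with a weaker constant: \<open>ln u \<le> 2 (sqrt u - 1)\<close> bounds the
  relative entropy from below by the squared Hellinger distance.\<close>
lemma bernoulli_relative_entropy:
  fixes p q :: real
  assumes "0 < p" "p < 1" "0 < q" "q < 1"
  shows "p * (ln q - ln p) + (1 - p) * (ln (1 - q) - ln (1 - p)) \<le> - (p - q)\<^sup>2 / 2"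
proof -
  have *: "a * (ln b - ln a) \<le> b - a - (sqrt a - sqrt b)\<^sup>2" if "0 < a" "0 < b" for a b :: real
  proof -
    have "a * (ln b - ln a) \<le> a * (2 * (sqrt (b / a) - 1))"
      using ln_le_sqrt[of "b / a"] that by (intro mult_left_mono) (auto simp: ln_div)
    also have "\<dots> = 2 * (sqrt a * sqrt b) - 2 * a"
    proof -
      have "a * sqrt (b / a) = sqrt a * sqrt a * (sqrt b / sqrt a)"
        using that by (simp add: real_sqrt_divide)
      also have "\<dots> = sqrt a * sqrt b"
        using that by (simp del: real_sqrt_mult_self)
      finally show ?thesis by (simp add: algebra_simps)
    qed
    also have "\<dots> = b - a - (sqrt a - sqrt b)\<^sup>2"
      using that by (simp add: power2_diff)
    finally show ?thesis .
  qed
  have "(p - q)\<^sup>2 / 4 \<le> (sqrt p - sqrt q)\<^sup>2"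
    using assms by (intro sqrt_diff_square_ge) auto
  moreover have "((1 - p) - (1 - q))\<^sup>2 / 4 \<le> (sqrt (1 - p) - sqrt (1 - q))\<^sup>2"
    using assms by (intro sqrt_diff_square_ge) auto
  moreover have "((1 - p) - (1 - q))\<^sup>2 = (p - q)\<^sup>2"
    by (simp add: power2_eq_square algebra_simps)
  ultimately show ?thesis
    using *[of p q] *[of "1 - p" "1 - q"] assms by simp
qed

definition logit :: "real \<Rightarrow> real" where
  "logit p = ln p - ln (1 - p)"

text \<open>If \<open>b\<close> is drawn with the true probability \<open>p\<close>, the log-likelihood ratio is its mean, which
  is minus a relative entropy, plus a centred term that is linear in \<open>b\<close>.\<close>
lemma edge_log_ratio:
  assumes "0 < p" "p < 1" "0 < q" "q < 1"
  shows "ln (edge_lik q b) - ln (edge_lik p b) \<le> - (p - q)\<^sup>2 / 2 + (of_bool b - p) * (logit q - logit p)"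
proof -
  have "ln (edge_lik q b) - ln (edge_lik p b) =
      p * (ln q - ln p) + (1 - p) * (ln (1 - q) - ln (1 - p)) + (of_bool b - p) * (logit q - logit p)"
    by (cases b) (auto simp: edge_lik_def logit_def algebra_simps)
  then show ?thesis
    using bernoulli_relative_entropy[OF assms] by simp
qed

lemma abs_logit_le:
  assumes "p \<in> {\<zeta>..1 - \<zeta>}" "0 < \<zeta>"
  shows "\<bar>logit p\<bar> \<le> - ln \<zeta>"
proof -
  have "ln \<zeta> \<le> ln p" "ln \<zeta> \<le> ln (1 - p)" "ln p \<le> 0" "ln (1 - p) \<le> 0"
    using assms by auto
  then show ?thesis by (auto simp: logit_def)
qed

text \<open>The weight of an edge depends on its type under \<open>z'\<close> only, so the weighted noise is a
  combination of \<open>Q\<^sup>2\<close> sums over edges of one type, and the bound is uniform in \<open>\<pi>'\<close>.\<close>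
lemma weighted_edge_noise:
  fixes \<pi> \<pi>' :: "real ^ 'q ^ ('q::finite)"
  assumes \<pi>': "\<And>q l. \<pi>' $ q $ l \<in> {\<zeta>..1 - \<zeta>}" "0 < \<zeta>"
    and noise: "\<And>a b. \<bar>\<Sum>e\<in>edges_of_type n T z' a b. edge_noise \<pi> z x e\<bar> \<le> s"
  shows "\<bar>\<Sum>(t, i, j)\<in>edge_index n T. edge_noise \<pi> z x (t, i, j) * logit (\<pi>' $ z' i t $ z' j t)\<bar>
    \<le> CARD('q) ^ 2 * (- ln \<zeta>) * s"
proof -
  let ?ty = "\<lambda>(t, i, j). (z' i t, z' j t)"
  have "(\<Sum>(t, i, j)\<in>edge_index n T. edge_noise \<pi> z x (t, i, j) * logit (\<pi>' $ z' i t $ z' j t)) =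
      (\<Sum>e\<in>edge_index n T. edge_noise \<pi> z x e * (case ?ty e of (a, b) \<Rightarrow> logit (\<pi>' $ a $ b)))"
    by (intro sum.cong) auto
  also have "\<dots> = (\<Sum>c\<in>UNIV. \<Sum>e\<in>{e \<in> edge_index n T. ?ty e = c}.
      edge_noise \<pi> z x e * (case ?ty e of (a, b) \<Rightarrow> logit (\<pi>' $ a $ b)))"
    by (rule sum.group[symmetric]) (auto simp: finite_edge_index)
  also have "\<dots> = (\<Sum>(a, b)\<in>UNIV. logit (\<pi>' $ a $ b) * (\<Sum>e\<in>edges_of_type n T z' a b. edge_noise \<pi> z x e))"
  proof (rule sum.cong)
    fix c :: "'q \<times> 'q"
    obtain a b where c: "c = (a, b)" by (cases c)
    have "{e \<in> edge_index n T. ?ty e = c} = edges_of_type n T z' a b"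
      by (auto simp: edges_of_type_def c)
    moreover have "(\<Sum>e\<in>edges_of_type n T z' a b. edge_noise \<pi> z x e * (case ?ty e of (a, b) \<Rightarrow> logit (\<pi>' $ a $ b))) =
        (\<Sum>e\<in>edges_of_type n T z' a b. logit (\<pi>' $ a $ b) * edge_noise \<pi> z x e)"
      by (intro sum.cong) (auto simp: edges_of_type_def)
    ultimately show "(\<Sum>e\<in>{e \<in> edge_index n T. ?ty e = c}.
        edge_noise \<pi> z x e * (case ?ty e of (a, b) \<Rightarrow> logit (\<pi>' $ a $ b))) =
        (case c of (a, b) \<Rightarrow> logit (\<pi>' $ a $ b) * (\<Sum>e\<in>edges_of_type n T z' a b. edge_noise \<pi> z x e))"
      by (simp add: c sum_distrib_left)
  qed simp
  also have "\<bar>\<dots>\<bar> \<le> (\<Sum>(a, b)\<in>(UNIV :: ('q \<times> 'q) set). - ln \<zeta> * s)"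
  proof (rule order_trans[OF sum_abs], rule sum_mono)
    fix c :: "'q \<times> 'q"
    obtain a b where c: "c = (a, b)" by (cases c)
    have "\<bar>logit (\<pi>' $ a $ b)\<bar> * \<bar>\<Sum>e\<in>edges_of_type n T z' a b. edge_noise \<pi> z x e\<bar> \<le> - ln \<zeta> * s"
      using abs_logit_le[OF \<pi>'(1)[of a b] \<pi>'(2)] noise[of a b] by (intro mult_mono) auto
    then show "\<bar>case c of (a, b) \<Rightarrow> logit (\<pi>' $ a $ b) * (\<Sum>e\<in>edges_of_type n T z' a b. edge_noise \<pi> z x e)\<bar>
        \<le> (case c of (a, b) \<Rightarrow> - ln \<zeta> * s)"
      by (simp add: c abs_mult)
  qed
  also have "\<dots> = CARD('q) ^ 2 * (- ln \<zeta>) * s"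
    by (simp add: split_def power2_eq_square)
  finally show ?thesis .
qed

text \<open>In the log-likelihood ratio of \<open>(\<pi>', z')\<close> to \<open>(\<pi>, z)\<close> the mean is at most minus half the
  total squared error, so a ratio that is not too small leaves room only for a squared error of the
  order of the noise and of the logarithm of the prior factor.\<close>
lemma squared_error_le:
  fixes \<pi> \<pi>' :: "real ^ 'q ^ ('q::finite)"
  assumes \<pi>: "\<And>q l. \<pi> $ q $ l \<in> {\<zeta>..1 - \<zeta>}" and \<pi>': "\<And>q l. \<pi>' $ q $ l \<in> {\<zeta>..1 - \<zeta>}"
    and "0 < \<zeta>" "0 < \<delta>"
    and noise: "\<And>a b. \<bar>\<Sum>e\<in>edges_of_type n T z a b. edge_noise \<pi> z x e\<bar> \<le> s"
      "\<And>a b. \<bar>\<Sum>e\<in>edges_of_type n T z' a b. edge_noise \<pi> z x e\<bar> \<le> s"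
    and lik: "\<delta> ^ (T * n) * graph_lik \<pi> n T z x \<le> graph_lik \<pi>' n T z' x"
  shows "(\<Sum>(t, i, j)\<in>edge_index n T. (\<pi> $ z i t $ z j t - \<pi>' $ z' i t $ z' j t)\<^sup>2)
    \<le> 2 * (real T * real n * (- ln \<delta>)) + 4 * (CARD('q) ^ 2 * (- ln \<zeta>) * s)"
proof -
  let ?E = "edge_index n T"
  let ?p = "\<lambda>(t, i, j). \<pi> $ z i t $ z j t" and ?p' = "\<lambda>(t, i, j). \<pi>' $ z' i t $ z' j t"
  let ?x = "\<lambda>(t, i, j). x t i j"
  have p: "?p e \<in> {\<zeta>..1 - \<zeta>}" "?p' e \<in> {\<zeta>..1 - \<zeta>}" for e
    using \<pi> \<pi>' by (cases e; simp)+
  then have p01: "0 < ?p e" "?p e < 1" "0 < ?p' e" "?p' e < 1" for e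
    using \<open>0 < \<zeta>\<close> by (smt (verit) atLeastAtMost_iff)+
  have pos: "0 < edge_lik (?p e) b" "0 < edge_lik (?p' e) b" for e b
    using p \<open>0 < \<zeta>\<close> edge_lik_pos by blast+
  have gl: "graph_lik \<pi> n T z x = (\<Prod>e\<in>?E. edge_lik (?p e) (?x e))"
    "graph_lik \<pi>' n T z' x = (\<Prod>e\<in>?E. edge_lik (?p' e) (?x e))"
    by (auto simp: graph_lik_def intro!: prod.cong)
  have ln_le: "ln (\<delta> ^ (T * n) * graph_lik \<pi> n T z x) \<le> ln (graph_lik \<pi>' n T z' x)"
    using lik graph_lik_pos[OF \<pi> \<open>0 < \<zeta>\<close>] graph_lik_pos[OF \<pi>' \<open>0 < \<zeta>\<close>] \<open>0 < \<delta>\<close>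
    by (subst ln_le_cancel_iff) auto
  have "real T * real n * ln \<delta> + (\<Sum>e\<in>?E. ln (edge_lik (?p e) (?x e))) \<le> (\<Sum>e\<in>?E. ln (edge_lik (?p' e) (?x e)))"
  proof -
    have "ln (\<Prod>e\<in>?E. g e) = (\<Sum>e\<in>?E. ln (g e))" if "\<And>e. 0 < g e" for g :: "_ \<Rightarrow> real"
      by (rule ln_prod) (rule finite_edge_index, rule less_imp_neq[OF that, symmetric])
    from this[OF pos(1)] this[OF pos(2)]
    have "ln (\<Prod>e\<in>?E. edge_lik (?p e) (?x e)) = (\<Sum>e\<in>?E. ln (edge_lik (?p e) (?x e)))"
      "ln (\<Prod>e\<in>?E. edge_lik (?p' e) (?x e)) = (\<Sum>e\<in>?E. ln (edge_lik (?p' e) (?x e)))" .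
    moreover have "ln (\<delta> ^ (T * n) * graph_lik \<pi> n T z x) = real T * real n * ln \<delta> + ln (graph_lik \<pi> n T z x)"
      using graph_lik_pos[OF \<pi> \<open>0 < \<zeta>\<close>, of n T z x] \<open>0 < \<delta>\<close> by (subst ln_mult_pos) (auto simp: ln_realpow)
    ultimately show ?thesis
      using ln_le
      unfolding gl by linarith
  qed
  then have "real T * real n * ln \<delta> \<le> (\<Sum>e\<in>?E. ln (edge_lik (?p' e) (?x e)) - ln (edge_lik (?p e) (?x e)))"
    by (simp add: sum_subtractf)
  also have "\<dots> \<le> (\<Sum>e\<in>?E. - (?p e - ?p' e)\<^sup>2 / 2 + (of_bool (?x e) - ?p e) * (logit (?p' e) - logit (?p e)))"
    by (intro sum_mono edge_log_ratio p01)
  also have "\<dots> = - (\<Sum>e\<in>?E. (?p e - ?p' e)\<^sup>2) / 2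
      + (\<Sum>e\<in>?E. edge_noise \<pi> z x e * logit (?p' e)) - (\<Sum>e\<in>?E. edge_noise \<pi> z x e * logit (?p e))"
  proof -
    have "edge_noise \<pi> z x e = of_bool (?x e) - ?p e" for e
      by (auto simp: edge_noise_def split: prod.split)
    then show ?thesis
      by (simp add: sum.distrib sum_subtractf right_diff_distrib sum_negf flip: sum_divide_distrib)
  qed
  finally have main: "real T * real n * ln \<delta> \<le> - (\<Sum>e\<in>?E. (?p e - ?p' e)\<^sup>2) / 2
      + (\<Sum>e\<in>?E. edge_noise \<pi> z x e * logit (?p' e)) - (\<Sum>e\<in>?E. edge_noise \<pi> z x e * logit (?p e))" .
  have "\<bar>\<Sum>e\<in>?E. edge_noise \<pi> z x e * logit (?p' e)\<bar> \<le> CARD('q) ^ 2 * (- ln \<zeta>) * s"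
    using weighted_edge_noise[OF \<pi>' \<open>0 < \<zeta>\<close> noise(2)] by (simp add: split_def)
  moreover have "\<bar>\<Sum>e\<in>?E. edge_noise \<pi> z x e * logit (?p e)\<bar> \<le> CARD('q) ^ 2 * (- ln \<zeta>) * s"
    using weighted_edge_noise[OF \<pi> \<open>0 < \<zeta>\<close> noise(1)] by (simp add: split_def)
  ultimately have "(\<Sum>e\<in>?E. (?p e - ?p' e)\<^sup>2)
      \<le> 2 * (real T * real n * (- ln \<delta>)) + 4 * (CARD('q) ^ 2 * (- ln \<zeta>) * s)"
    using main by linarith
  then show ?thesis
    by (simp add: split_def)
qed

section \<open>From squared error to a matching of the classes\<close>

definition pairs :: "nat \<Rightarrow> (nat \<times> nat) set" where
  "pairs n = {(i, j). i \<in> {1..n} \<and> j \<in> {1..n} \<and> i < j}"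

lemma edge_index_eq: "edge_index n T = {1..T} \<times> pairs n"
  by (auto simp: edge_index_def pairs_def)

lemma finite_pairs: "finite (pairs n)"
  by (rule finite_subset[of _ "{1..n} \<times> {1..n}"]) (auto simp: pairs_def)

lemma exists_time_le_average:
  fixes g :: "nat \<times> nat \<times> nat \<Rightarrow> real" and V :: real
  assumes "(\<Sum>e\<in>edge_index n T. g e) \<le> T * V" "T \<ge> 1"
  shows "\<exists>t\<in>{1..T}. (\<Sum>(i, j)\<in>pairs n. g (t, i, j)) \<le> V"
proof (rule ccontr)
  assume *: "\<not> ?thesis"
  have "T * V = (\<Sum>t\<in>{1..T}. V)"
    by simp
  also have "\<dots> < (\<Sum>t\<in>{1..T}. \<Sum>(i, j)\<in>pairs n. g (t, i, j))"
    using * assms(2) by (intro sum_strict_mono) (auto simp: not_le)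
  also have "\<dots> = (\<Sum>e\<in>edge_index n T. g e)"
    unfolding edge_index_eq by (simp add: sum.cartesian_product split_def)
  finally show False
    using assms(1) by simp
qed

lemma sum_pairs_symmetric:
  fixes g :: "nat \<Rightarrow> nat \<Rightarrow> real"
  assumes "\<And>i j. g i j = g j i"
  shows "(\<Sum>(i, j)\<in>{(i, j). i \<in> {1..n} \<and> j \<in> {1..n} \<and> i \<noteq> j}. g i j) = 2 * (\<Sum>(i, j)\<in>pairs n. g i j)"
proof -
  have "{(i, j). i \<in> {1..n} \<and> j \<in> {1..n} \<and> i \<noteq> j} = pairs n \<union> prod.swap ` pairs n"
    by (force simp: pairs_def image_iff)
  moreover have "pairs n \<inter> prod.swap ` pairs n = {}"
    by (auto simp: pairs_def)
  moreover have "(\<Sum>(i, j)\<in>prod.swap ` pairs n. g i j) = (\<Sum>(i, j)\<in>pairs n. g i j)"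
    using assms by (subst sum.reindex) (auto intro!: sum.cong)
  ultimately show ?thesis
    using finite_pairs by (simp add: sum.union_disjoint)
qed

lemma majority_class:
  fixes c c' :: "nat \<Rightarrow> 'q::finite" and m :: real
  assumes "CARD('q) * m \<le> real (card {i\<in>{1..n}. c i = q})"
  shows "\<exists>a. m \<le> real (card {i\<in>{1..n}. c i = q \<and> c' i = a})"
proof (rule ccontr)
  assume *: "\<not> ?thesis"
  have "{i\<in>{1..n}. c i = q} = (\<Union>a. {i\<in>{1..n}. c i = q \<and> c' i = a})"
    by auto
  also have "card \<dots> = (\<Sum>a\<in>UNIV. card {i\<in>{1..n}. c i = q \<and> c' i = a})"
    by (intro card_UN_disjoint) auto
  finally have "real (card {i\<in>{1..n}. c i = q}) = (\<Sum>a\<in>UNIV. real (card {i\<in>{1..n}. c i = q \<and> c' i = a}))"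
    by simp
  also have "\<dots> < (\<Sum>a\<in>(UNIV :: 'q set). m)"
    using * by (intro sum_strict_mono) (auto simp: not_le)
  finally show False
    using assms by simp
qed

text \<open>Match \<open>q\<close> with a label \<open>f q\<close> which \<open>c'\<close> gives to at least \<open>m\<close> of its nodes. All pairs of nodes
  that represent \<open>q\<close> and \<open>l\<close> in this way contribute the same term to the squared error, and
  there are at least \<open>m\<^sup>2 / 2\<close> ordered ones.\<close>
lemma one_graph_matching:
  fixes \<pi> \<pi>' :: "real ^ 'q ^ ('q::finite)" and c c' :: "nat \<Rightarrow> 'q" and m :: real
  assumes symm: "\<And>q l. \<pi> $ q $ l = \<pi> $ l $ q" "\<And>q l. \<pi>' $ q $ l = \<pi>' $ l $ q"
    and err: "(\<Sum>(i, j)\<in>pairs n. (\<pi> $ c i $ c j - \<pi>' $ c' i $ c' j)\<^sup>2) \<le> V"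
    and sizes: "\<And>q. CARD('q) * m \<le> real (card {i\<in>{1..n}. c i = q})" and "2 \<le> m"
  shows "\<exists>f. \<forall>q l. (\<pi> $ q $ l - \<pi>' $ f q $ f l)\<^sup>2 \<le> 4 * V / m\<^sup>2"
proof -
  have "\<forall>q. \<exists>a. m \<le> real (card {i\<in>{1..n}. c i = q \<and> c' i = a})"
    using majority_class[OF sizes] by blast
  then obtain f where f: "\<And>q. m \<le> real (card {i\<in>{1..n}. c i = q \<and> c' i = f q})"
    by metis
  have "(\<pi> $ q $ l - \<pi>' $ f q $ f l)\<^sup>2 \<le> 4 * V / m\<^sup>2" for q l
  proof -
    define A where "A q = {i\<in>{1..n}. c i = q \<and> c' i = f q}" for q
    define P where "P = (SIGMA i:A q. A l - {i})"
    let ?g = "\<lambda>i j. (\<pi> $ c i $ c j - \<pi>' $ c' i $ c' j)\<^sup>2"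
    let ?d = "(\<pi> $ q $ l - \<pi>' $ f q $ f l)\<^sup>2"
    have fin: "finite (A q)" for q
      by (simp add: A_def)
    have A: "m \<le> real (card (A q))" for q
      using f by (simp add: A_def)
    \<comment> \<open>For \<open>q = l\<close> the diagonal has to be left out, which costs one element of \<open>A l\<close>; \<open>2 \<le> m\<close>
      turns \<open>m - 1\<close> into \<open>m / 2\<close>.\<close>
    have "m * (m / 2) \<le> real (card (A q)) * (real (card (A l)) - 1)"
      using A[of q] A[of l] \<open>2 \<le> m\<close> by (intro mult_mono) auto
    also have "\<dots> \<le> real (card P)"
    proof -
      have "real (card (A l)) - 1 \<le> real (card (A l - {i}))" for i
        using diff_card_le_card_Diff[of "{i}" "A l"] by simp
      then have "(\<Sum>i\<in>A q. real (card (A l)) - 1) \<le> (\<Sum>i\<in>A q. real (card (A l - {i})))"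
        by (intro sum_mono)
      then show ?thesis
        unfolding P_def using fin by (simp add: card_SigmaI)
    qed
    finally have "?d * (m * (m / 2)) \<le> ?d * card P"
      by (intro mult_left_mono) auto
    also have "?d * card P = (\<Sum>e\<in>P. ?d)"
      by simp
    also have "\<dots> = (\<Sum>(i, j)\<in>P. ?g i j)"
      by (intro sum.cong) (auto simp: P_def A_def)
    also have "\<dots> \<le> (\<Sum>(i, j)\<in>{(i, j). i \<in> {1..n} \<and> j \<in> {1..n} \<and> i \<noteq> j}. ?g i j)"
    proof (rule sum_mono2)
      show "finite {(i, j). i \<in> {1..n} \<and> j \<in> {1..n} \<and> i \<noteq> j}"
        by (rule finite_subset[of _ "{1..n} \<times> {1..n}"]) auto
    qed (auto simp: P_def A_def)
    also have "\<dots> = 2 * (\<Sum>(i, j)\<in>pairs n. ?g i j)"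
      using symm by (intro sum_pairs_symmetric) metis
    also have "\<dots> \<le> 2 * V"
      using err by simp
    finally show ?thesis
      using \<open>2 \<le> m\<close> by (simp add: field_simps power2_eq_square)
  qed
  then show ?thesis by blast
qed


section \<open>The maximum likelihood estimator\<close>

definition good_event ::
    "real \<Rightarrow> real ^ 'q ^ 'q \<Rightarrow> nat \<Rightarrow> nat \<Rightarrow> (('q::finite) labels \<times> graphs) set" where
  "good_event \<delta> \<pi> n T = {(z, x). z \<in> label_space n T \<and> x \<in> graph_space n T \<and>
     (\<forall>t\<in>{1..T}. \<forall>q. \<delta> * n / 2 \<le> real (card {i\<in>{1..n}. z i t = q})) \<and>
     (\<forall>z'\<in>label_space n T :: 'q labels set. \<forall>a b.
        \<bar>\<Sum>e\<in>edges_of_type n T z' a b. edge_noise \<pi> z x e\<bar> \<le> CARD('q) * real n powr (3 / 2) * T)}"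

lemma prob_not_good_event:
  fixes \<theta>\<^sub>0 :: "('q::finite) param"
  assumes "\<theta>\<^sub>0 \<in> closed_param_space \<delta> \<zeta>" "0 < \<delta>" "0 < \<zeta>" "n \<ge> 1" "T \<ge> 1"
  shows "measure_pmf.prob (dsbm_pmf \<theta>\<^sub>0 n T) (- good_event \<delta> (snd \<theta>\<^sub>0) n T)
    \<le> real T * CARD('q) * exp (- \<delta>\<^sup>2 * n / 2) + 2 * CARD('q) ^ 2 * exp (- real n)"
proof -
  let ?M = "dsbm_pmf \<theta>\<^sub>0 n T"
  note \<theta> = closed_param_spaceD[OF assms(1)]
  define B\<^sub>1 where "B\<^sub>1 = {z :: 'q labels. \<exists>t\<in>{1..T}. \<exists>q. real (card {i\<in>{1..n}. z i t = q}) < \<delta> * n / 2}"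
  define B\<^sub>2 where "B\<^sub>2 z = {x. \<exists>z'\<in>label_space n T :: 'q labels set. \<exists>a b.
    CARD('q) * real n powr (3 / 2) * T \<le> \<bar>\<Sum>e\<in>edges_of_type n T z' a b. edge_noise (snd \<theta>\<^sub>0) z x e\<bar>}" for z
  have "(- good_event \<delta> (snd \<theta>\<^sub>0) n T) \<inter> set_pmf ?M \<subseteq> (fst -` B\<^sub>1) \<union> {(z, x). x \<in> B\<^sub>2 z}"
  proof
    fix y assume y: "y \<in> (- good_event \<delta> (snd \<theta>\<^sub>0) n T) \<inter> set_pmf ?M"
    obtain z x where zx: "y = (z, x)"
      by (cases y)
    have "z \<in> set_pmf (labels_pmf (fst \<theta>\<^sub>0) n T)" "x \<in> set_pmf (graphs_pmf (snd \<theta>\<^sub>0) n T z)"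
      using y unfolding zx dsbm_pmf_eq set_bind_pmf set_map_pmf by auto
    then have "z \<in> label_space n T" "x \<in> graph_space n T"
      using set_labels_pmf set_graphs_pmf by blast+
    moreover have "(z, x) \<notin> good_event \<delta> (snd \<theta>\<^sub>0) n T"
      using y zx by simp
    ultimately have "z \<in> B\<^sub>1 \<or> x \<in> B\<^sub>2 z"
      unfolding good_event_def B\<^sub>1_def B\<^sub>2_def mem_Collect_eq prod.case
      by (meson not_le less_imp_le)
    then show "y \<in> (fst -` B\<^sub>1) \<union> {(z, x). x \<in> B\<^sub>2 z}"
      by (auto simp: zx)
  qed
  then have "measure_pmf.prob ?M ((- good_event \<delta> (snd \<theta>\<^sub>0) n T) \<inter> set_pmf ?M) \<le>
      measure_pmf.prob ?M ((fst -` B\<^sub>1) \<union> {(z, x). x \<in> B\<^sub>2 z})"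
    by (intro measure_pmf.finite_measure_mono) auto
  then have "measure_pmf.prob ?M (- good_event \<delta> (snd \<theta>\<^sub>0) n T) \<le>
      measure_pmf.prob ?M ((fst -` B\<^sub>1) \<union> {(z, x). x \<in> B\<^sub>2 z})"
    by (simp add: measure_Int_set_pmf)
  also have "\<dots> \<le> measure_pmf.prob ?M (fst -` B\<^sub>1) + measure_pmf.prob ?M {(z, x). x \<in> B\<^sub>2 z}"
    by (intro measure_Un_le) auto
  also have "measure_pmf.prob ?M (fst -` B\<^sub>1) \<le> real T * CARD('q) * exp (- \<delta>\<^sup>2 * n / 2)"
  proof -
    have "map_pmf fst ?M = labels_pmf (fst \<theta>\<^sub>0) n T"
      by (simp add: dsbm_pmf_eq map_bind_pmf map_pmf_comp bind_return_pmf')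
    then have "measure_pmf.prob ?M (fst -` B\<^sub>1) = measure_pmf.prob (labels_pmf (fst \<theta>\<^sub>0) n T) B\<^sub>1"
      by (metis measure_map_pmf)
    also have "\<dots> \<le> real T * CARD('q) * exp (- \<delta>\<^sup>2 * n / 2)"
      unfolding B\<^sub>1_def by (rule class_sizes_concentrate[OF \<theta>(1) assms(2) \<theta>(2) assms(4)])
    finally show ?thesis .
  qed
  also have "measure_pmf.prob ?M {(z, x). x \<in> B\<^sub>2 z} \<le> 2 * CARD('q) ^ 2 * exp (- real n)"
    unfolding dsbm_pmf_eq
  proof (rule prob_bind_pmf_le)
    fix z :: "'q labels"
    have "snd \<theta>\<^sub>0 $ q $ l \<in> {0..1}" for q l
      using \<theta>(3)[of q l] assms(3) by auto
    then show "measure_pmf.prob (map_pmf (Pair z) (graphs_pmf (snd \<theta>\<^sub>0) n T z)) {(z, x). x \<in> B\<^sub>2 z}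
        \<le> 2 * CARD('q) ^ 2 * exp (- real n)"
      unfolding measure_map_pmf vimage_def B\<^sub>2_def
      using edge_noise_uniform_tail[of "snd \<theta>\<^sub>0" n T z] assms(4,5) by simp
  qed
  finally show ?thesis by simp
qed

text \<open>Under the square root is the constant \<open>B\<close> for which the total squared error is at most
  \<open>B n\<^bsup>3/2\<^esup> T\<close>; the factor \<open>4 Q / \<delta>\<close> comes from representing every class by \<open>\<delta> n / (2 Q)\<close>
  nodes.\<close>
definition rate_const :: "real \<Rightarrow> real \<Rightarrow> nat \<Rightarrow> real" where
  "rate_const \<delta> \<zeta> Q = 4 * Q / \<delta> * sqrt (2 * (- ln \<delta>) + 4 * (real Q ^ 3 * (- ln \<zeta>)))"

text \<open>Stated over \<open>closed_param_space\<close> in order to apply to its maximisers, whose rows turn out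
  to be distinct only as a consequence.\<close>
lemma likely_params_match:
  fixes \<theta>\<^sub>0 \<theta> :: "('q::finite) param"
  assumes \<theta>\<^sub>0: "\<theta>\<^sub>0 \<in> closed_param_space \<delta> \<zeta>" and \<theta>: "\<theta> \<in> closed_param_space \<delta> \<zeta>"
    and "0 < \<delta>" "\<delta> < 1" "0 < \<zeta>" "\<zeta> < 1" "T \<ge> 1" "4 * real CARD('q) / \<delta> \<le> n"
    and good: "(z, x) \<in> good_event \<delta> (snd \<theta>\<^sub>0) n T"
    and lik: "lik n T x \<theta>\<^sub>0 \<le> lik n T x \<theta>"
  shows "\<exists>f. \<forall>q l. \<bar>snd \<theta>\<^sub>0 $ q $ l - snd \<theta> $ f q $ f l\<bar> \<le> rate_const \<delta> \<zeta> CARD('q) * n powr (- 1 / 4)"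
proof -
  let ?Q = "real CARD('q)" and ?\<pi> = "snd \<theta>\<^sub>0" and ?\<pi>' = "snd \<theta>"
  define B where "B = 2 * (- ln \<delta>) + 4 * (?Q ^ 3 * (- ln \<zeta>))"
  have Q: "0 < ?Q" by simp
  have "0 < 4 * ?Q / \<delta>"
    using \<open>0 < \<delta>\<close> Q by simp
  then have n: "1 \<le> n"
    using assms(8) by (cases n) auto
  have logs: "ln \<delta> < 0" "ln \<zeta> < 0"
    using assms by auto
  then have "0 \<le> ?Q ^ 3 * (- ln \<zeta>)"
    by (intro mult_nonneg_nonneg) auto
  with logs have "0 \<le> B"
    unfolding B_def by linarith
  have z: "z \<in> label_space n T" and x: "x \<in> graph_space n T"
    and sizes: "\<And>t q. t \<in> {1..T} \<Longrightarrow> \<delta> * n / 2 \<le> real (card {i\<in>{1..n}. z i t = q})"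
    and noise: "\<And>(z' :: 'q labels) a b. z' \<in> label_space n T \<Longrightarrow>
      \<bar>\<Sum>e\<in>edges_of_type n T z' a b. edge_noise ?\<pi> z x e\<bar> \<le> ?Q * real n powr (3 / 2) * T"
    using good by (auto simp: good_event_def)
  obtain z' where z': "z' \<in> label_space n T" "lik n T x \<theta> \<le> graph_lik ?\<pi>' n T z' x"
    using lik_le[OF \<theta> \<open>0 < \<zeta>\<close> x] by blast
  have "\<delta> ^ (T * n) * graph_lik ?\<pi> n T z x \<le> graph_lik ?\<pi>' n T z' x"
    using lik_ge[OF \<theta>\<^sub>0 \<open>0 < \<delta>\<close> \<open>0 < \<zeta>\<close> x z] lik z'(2) by linarith
  from squared_error_le[OF closed_param_spaceD(3)[OF \<theta>\<^sub>0] closed_param_spaceD(3)[OF \<theta>] \<open>0 < \<zeta>\<close> \<open>0 < \<delta>\<close>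
      noise[OF z] noise[OF z'(1)] this]
  have "(\<Sum>(t, i, j)\<in>edge_index n T. (?\<pi> $ z i t $ z j t - ?\<pi>' $ z' i t $ z' j t)\<^sup>2)
      \<le> 2 * (real T * real n * (- ln \<delta>)) + 4 * (?Q ^ 2 * (- ln \<zeta>) * (?Q * real n powr (3 / 2) * T))"
    by simp
  also have "\<dots> \<le> T * (B * real n powr (3 / 2))"
  proof -
    have "real n = real n powr 1"
      using n by simp
    also have "\<dots> \<le> real n powr (3 / 2)"
      using n by (intro powr_mono) auto
    finally have "real T * (- ln \<delta>) * real n \<le> real T * (- ln \<delta>) * real n powr (3 / 2)"
      using logs by (intro mult_left_mono mult_nonneg_nonneg) auto
    then show ?thesis
      by (simp add: B_def algebra_simps power2_eq_square power3_eq_cube)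
  qed
  finally have "(\<Sum>(t, i, j)\<in>edge_index n T. (?\<pi> $ z i t $ z j t - ?\<pi>' $ z' i t $ z' j t)\<^sup>2)
      \<le> T * (B * real n powr (3 / 2))" .
  from exists_time_le_average[OF this \<open>T \<ge> 1\<close>] obtain t where t: "t \<in> {1..T}"
    and err: "(\<Sum>(i, j)\<in>pairs n. (?\<pi> $ z i t $ z j t - ?\<pi>' $ z' i t $ z' j t)\<^sup>2) \<le> B * real n powr (3 / 2)"
    by auto
  let ?m = "\<delta> * n / (2 * ?Q)"
  have "2 \<le> ?m"
    using assms(8) \<open>0 < \<delta>\<close> Q by (simp add: field_simps)
  moreover have "?Q * ?m \<le> real (card {i\<in>{1..n}. z i t = q})" for q
    using sizes[OF t, of q] by simp
  ultimately obtain f where f: "\<And>q l. (?\<pi> $ q $ l - ?\<pi>' $ f q $ f l)\<^sup>2 \<le> 4 * (B * real n powr (3 / 2)) / ?m\<^sup>2"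
    using one_graph_matching[OF closed_param_spaceD(4)[OF \<theta>\<^sub>0] closed_param_spaceD(4)[OF \<theta>] err] by blast
  let ?r = "rate_const \<delta> \<zeta> CARD('q) * n powr (- 1 / 4)"
  have "4 * (B * real n powr (3 / 2)) / ?m\<^sup>2 = ?r\<^sup>2"
  proof -
    have "(real n powr (- 1 / 4))\<^sup>2 = real n powr (3 / 2) / (real n)\<^sup>2"
    proof -
      have "real n powr (3 / 2 - 2) = real n powr (3 / 2) / real n powr 2"
        by (rule powr_diff)
      moreover have "(real n powr (- 1 / 4))\<^sup>2 = real n powr (- 1 / 2)"
        using n by (simp add: powr_power)
      ultimately show ?thesis
        using n by (simp add: powr_numeral)
    qed
    moreover have "rate_const \<delta> \<zeta> CARD('q) = 4 * ?Q / \<delta> * sqrt B"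
      unfolding rate_const_def B_def ..
    ultimately show ?thesis
      using \<open>0 \<le> B\<close> \<open>0 < \<delta>\<close> n Q by (simp add: power_mult_distrib power_divide mult_ac)
  qed
  moreover have "0 \<le> ?r"
    using \<open>0 \<le> B\<close> \<open>0 < \<delta>\<close> by (simp add: rate_const_def B_def)
  ultimately have "\<bar>?\<pi> $ q $ l - ?\<pi>' $ f q $ f l\<bar> \<le> ?r" for q l
    using f[of q l] by (metis abs_le_square_iff abs_of_nonneg)
  then show ?thesis by blast
qed

text \<open>Two classes with the same match would have rows of \<open>\<pi>\<close> within \<open>2 \<eta>\<close> of each other.\<close>
lemma approximate_matching_permutes:
  fixes \<pi> \<pi>' :: "real ^ 'q ^ ('q::finite)"
  assumes gap: "\<And>q q'. q \<noteq> q' \<Longrightarrow> \<exists>l. 2 * \<eta> < \<bar>\<pi> $ q $ l - \<pi> $ q' $ l\<bar>"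
    and close: "\<And>q l. \<bar>\<pi> $ q $ l - \<pi>' $ f q $ f l\<bar> \<le> \<eta>"
  shows "f permutes UNIV" "distinct_rows \<pi>'"
proof -
  have sep: "\<exists>l. \<pi>' $ f q $ f l \<noteq> \<pi>' $ f q' $ f l" if neq: "q \<noteq> q'" for q q'
  proof -
    obtain l where "2 * \<eta> < \<bar>\<pi> $ q $ l - \<pi> $ q' $ l\<bar>"
      using gap[OF neq] by blast
    with close[of q l] close[of q' l] have "\<pi>' $ f q $ f l \<noteq> \<pi>' $ f q' $ f l"
      by linarith
    then show ?thesis ..
  qed
  then have "inj f"
    by (metis injI)
  then have "bij f"
    using finite_UNIV_inj_surj[of f] by (auto simp: bij_def)
  then show "f permutes UNIV"
    by (intro bij_imp_permutes) auto
  show "distinct_rows \<pi>'"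
    unfolding distinct_rows_def
  proof (intro allI impI)
    fix a b :: 'q assume "a \<noteq> b"
    obtain q q' where "a = f q" "b = f q'"
      using \<open>bij f\<close> by (metis bij_pointE)
    with \<open>a \<noteq> b\<close> sep[of q q'] show "\<exists>l. \<pi>' $ a $ l \<noteq> \<pi>' $ b $ l"
      by auto
  qed
qed

text \<open>The specification of the estimator says something only when a maximiser over the parameter
  space exists, so the maximiser over \<open>closed_param_space\<close> is first shown to be one.\<close>
lemma mle_close:
  fixes \<delta> \<zeta> :: real and \<theta>\<^sub>0 :: "('q::finite) param" and est :: "nat \<Rightarrow> nat \<Rightarrow> graphs \<Rightarrow> 'q param"
  defines "\<eta> n \<equiv> rate_const \<delta> \<zeta> CARD('q) * real n powr (- 1 / 4)"
  assumes \<theta>\<^sub>0: "\<theta>\<^sub>0 \<in> closed_param_space \<delta> \<zeta>" and mle: "is_mle \<delta> \<zeta> est"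
    and "0 < \<delta>" "\<delta> < 1" "0 < \<zeta>" "\<zeta> < 1" "T \<ge> 1" "4 * real CARD('q) / \<delta> \<le> n"
    and gap: "\<And>q q'. q \<noteq> q' \<Longrightarrow> \<exists>l. 2 * \<eta> n < \<bar>snd \<theta>\<^sub>0 $ q $ l - snd \<theta>\<^sub>0 $ q' $ l\<bar>"
    and good: "(z, x) \<in> good_event \<delta> (snd \<theta>\<^sub>0) n T"
  shows "(MIN \<sigma> \<in> {\<sigma>. \<sigma> permutes (UNIV :: 'q set)}.
      max_norm (snd \<theta>\<^sub>0 - permute_mat \<sigma> (snd (est n T x)))) \<le> \<eta> n"
proof -
  have x: "x \<in> graph_space n T"
    using good by (auto simp: good_event_def)
  note pos = lik_pos[OF _ \<open>0 < \<delta>\<close> \<open>0 < \<zeta>\<close> x]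
  have log_lik: "log_lik n T x \<theta> = ln (lik n T x \<theta>)" for \<theta> :: "'q param"
    by (simp add: log_lik_def lik_def)
  have match: "\<exists>f. \<forall>q l. \<bar>snd \<theta>\<^sub>0 $ q $ l - snd \<theta> $ f q $ f l\<bar> \<le> \<eta> n"
    if "\<theta> \<in> closed_param_space \<delta> \<zeta>" "lik n T x \<theta>\<^sub>0 \<le> lik n T x \<theta>" for \<theta> :: "'q param"
    unfolding \<eta>_def by (rule likely_params_match[OF \<theta>\<^sub>0 that(1) assms(4-9) good that(2)])
  have "distinct_rows (snd \<theta>\<^sub>0)"
    using match[OF \<theta>\<^sub>0] approximate_matching_permutes(2)[OF gap] by blast
  then have \<theta>\<^sub>0': "\<theta>\<^sub>0 \<in> param_space \<delta> \<zeta>"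
    using \<theta>\<^sub>0 by (simp add: param_space_eq)
  obtain \<theta>' :: "'q param" where \<theta>': "\<theta>' \<in> closed_param_space \<delta> \<zeta>"
    and max: "\<And>\<theta> :: 'q param. \<theta> \<in> closed_param_space \<delta> \<zeta> \<Longrightarrow> lik n T x \<theta> \<le> lik n T x \<theta>'"
    using lik_attains_max[OF \<theta>\<^sub>0 \<open>0 < \<delta>\<close> \<open>0 < \<zeta>\<close> x] by blast
  have "distinct_rows (snd \<theta>')"
    using match[OF \<theta>' max[OF \<theta>\<^sub>0]] approximate_matching_permutes(2)[OF gap] by blast
  then have "is_arg_max (log_lik n T x) (\<lambda>\<theta>. \<theta> \<in> param_space \<delta> \<zeta>) \<theta>'"
    unfolding is_arg_max_linorder
  proof (intro conjI allI impI)
    fix \<theta> :: "'q param" assume "\<theta> \<in> param_space \<delta> \<zeta>"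
    then have "\<theta> \<in> closed_param_space \<delta> \<zeta>"
      by (simp add: param_space_eq)
    with max[OF this] pos[OF this] pos[OF \<theta>'] show "log_lik n T x \<theta> \<le> log_lik n T x \<theta>'"
      by (simp add: log_lik)
  qed (use \<theta>' in \<open>simp add: param_space_eq\<close>)
  then have "is_arg_max (log_lik n T x) (\<lambda>\<theta>. \<theta> \<in> param_space \<delta> \<zeta>) (est n T x)"
    using mle unfolding is_mle_def by blast
  then have est_mem: "est n T x \<in> param_space \<delta> \<zeta>"
    and est_max: "log_lik n T x \<theta>\<^sub>0 \<le> log_lik n T x (est n T x)"
    using \<theta>\<^sub>0' unfolding is_arg_max_linorder by blast+
  from est_mem have est: "est n T x \<in> closed_param_space \<delta> \<zeta>"
    by (simp add: param_space_eq)
  have "lik n T x \<theta>\<^sub>0 \<le> lik n T x (est n T x)"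
    using est_max pos[OF \<theta>\<^sub>0] pos[OF est] by (simp add: log_lik)
  from match[OF est this] obtain \<sigma>
    where \<sigma>: "\<And>q l. \<bar>snd \<theta>\<^sub>0 $ q $ l - snd (est n T x) $ \<sigma> q $ \<sigma> l\<bar> \<le> \<eta> n"
    by blast
  have "\<sigma> permutes UNIV"
    by (rule approximate_matching_permutes(1)[OF gap \<sigma>])
  then have "(MIN \<sigma> \<in> {\<sigma>. \<sigma> permutes (UNIV :: 'q set)}. max_norm (snd \<theta>\<^sub>0 - permute_mat \<sigma> (snd (est n T x))))
      \<le> max_norm (snd \<theta>\<^sub>0 - permute_mat \<sigma> (snd (est n T x)))"
    by (intro Min_le) (auto simp: finite_permutations)
  also have "\<dots> \<le> \<eta> n"
    unfolding max_norm_def using \<sigma> by (subst Max_le_iff) (auto simp: permute_mat_def)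
  finally show ?thesis .
qed

lemma distinct_rows_gap:
  fixes \<pi> :: "real ^ 'q ^ ('q::finite)"
  assumes "distinct_rows \<pi>"
  shows "\<exists>\<gamma>>0. \<forall>q q'. q \<noteq> q' \<longrightarrow> (\<exists>l. \<gamma> \<le> \<bar>\<pi> $ q $ l - \<pi> $ q' $ l\<bar>)"
proof -
  define D where "D = insert 1 ((\<lambda>(q, q', l). \<bar>\<pi> $ q $ l - \<pi> $ q' $ l\<bar>) ` UNIV - {0})"
  have "finite D" "D \<noteq> {}" "\<forall>d\<in>D. 0 < d"
    by (auto simp: D_def)
  then have "0 < Min D" and le: "\<And>d. d \<in> D \<Longrightarrow> Min D \<le> d"
    by auto
  moreover have "\<exists>l. Min D \<le> \<bar>\<pi> $ q $ l - \<pi> $ q' $ l\<bar>" if neq: "q \<noteq> q'" for q q'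
  proof -
    obtain l where "\<pi> $ q $ l \<noteq> \<pi> $ q' $ l"
      using assms neq unfolding distinct_rows_def by blast
    then have "\<bar>\<pi> $ q $ l - \<pi> $ q' $ l\<bar> \<in> D"
      unfolding D_def by (intro insertI2 DiffI image_eqI[of _ _ "(q, q', l)"]) auto
    then show ?thesis
      using le by blast
  qed
  ultimately show ?thesis by blast
qed

theorem corollary1:
  fixes \<delta> \<zeta> \<epsilon> :: real
    and \<theta>\<^sub>0 :: "('q::finite) param"
    and est :: "nat \<Rightarrow> nat \<Rightarrow> graphs \<Rightarrow> 'q param"
    and r :: "nat \<Rightarrow> nat \<Rightarrow> real"
    and F :: "(nat \<times> nat) filter"
  assumes "CARD('q) \<ge> 2"
    and "0 < \<delta>" "\<delta> < 1 / real CARD('q)"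
    and "0 < \<zeta>" "\<zeta> < 1 / 2"
    and "\<theta>\<^sub>0 \<in> param_space \<delta> \<zeta>"
    and "is_mle \<delta> \<zeta> est"
    and "F \<le> sequentially \<times>\<^sub>F sequentially"
    and "(\<lambda>(n, T). ln (real T)) \<in> o[F](\<lambda>(n, T). real n)"
    and "\<And>n T. n \<ge> 1 \<Longrightarrow> T \<ge> 1 \<Longrightarrow> r n T > 0"
    and "filterlim (\<lambda>(n, T). r n T) at_top F"
    and "(\<lambda>(n, T). r n T) \<in> o[F](\<lambda>(n, T). real n powr (1 / 4))"
    and "\<epsilon> > 0"
  shows "((\<lambda>(n, T). measure_pmf.prob (dsbm_pmf \<theta>\<^sub>0 n T)
            {(z, x). (MIN \<sigma> \<in> {\<sigma>. \<sigma> permutes (UNIV :: 'q set)}.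
                        max_norm (snd \<theta>\<^sub>0 - permute_mat \<sigma> (snd (est n T x))))
                     > \<epsilon> * r n T / real n powr (1 / 4)})
          \<longlongrightarrow> 0) F"
proof -
  let ?Q = "real CARD('q)"
  define C where "C = rate_const \<delta> \<zeta> CARD('q)"
  define bound where "bound n = ?Q * exp (- (\<delta>\<^sup>2 / 4) * n) + 2 * ?Q ^ 2 * exp (- n)" for n :: real
  have \<theta>\<^sub>0: "\<theta>\<^sub>0 \<in> closed_param_space \<delta> \<zeta>" "distinct_rows (snd \<theta>\<^sub>0)"
    using assms(6) by (auto simp: param_space_eq)
  have "1 / ?Q \<le> 1"
    using assms(1) by simp
  then have "\<delta> < 1"
    using assms(3) by linarith
  have "\<zeta> < 1"
    using assms(5) by simp
  obtain \<gamma> where \<gamma>: "0 < \<gamma>" "\<And>q q'. q \<noteq> q' \<Longrightarrow> \<exists>l. \<gamma> \<le> \<bar>snd \<theta>\<^sub>0 $ q $ l - snd \<theta>\<^sub>0 $ q' $ l\<bar>"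
    using distinct_rows_gap[OF \<theta>\<^sub>0(2)] by blast
  have n_lim: "filterlim (\<lambda>p. real (fst p)) at_top F"
    by (rule filterlim_compose[OF filterlim_real_sequentially])
      (rule filterlim_mono[OF filterlim_fst order_refl assms(8)])
  have T_lim: "filterlim snd sequentially F"
    by (rule filterlim_mono[OF filterlim_snd order_refl assms(8)])
  have ev_T: "\<forall>\<^sub>F p in F. 1 \<le> snd p"
    using T_lim by (simp add: filterlim_at_top)
  have ev_n: "\<forall>\<^sub>F p in F. max 1 (4 * ?Q / \<delta>) \<le> real (fst p)"
    using n_lim unfolding filterlim_at_top by blast
  have ev_gap: "\<forall>\<^sub>F p in F. 2 * (C * real (fst p) powr (- 1 / 4)) < \<gamma>"
  proof -
    have "((\<lambda>n. 2 * (C * n powr (- 1 / 4))) \<longlongrightarrow> 2 * (C * 0)) at_top"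
      by (intro tendsto_intros tendsto_neg_powr filterlim_ident) simp
    from filterlim_compose[OF this n_lim]
    have "((\<lambda>p. 2 * (C * real (fst p) powr (- 1 / 4))) \<longlongrightarrow> 0) F"
      by simp
    then show ?thesis
      using \<gamma>(1) by (rule order_tendstoD)
  qed
  have ev_log: "\<forall>\<^sub>F p in F. norm (ln (real (snd p))) \<le> \<delta>\<^sup>2 / 4 * norm (real (fst p))"
    using landau_o.smallD[OF assms(9), of "\<delta>\<^sup>2 / 4"] assms(2) by (simp add: split_def)
  have ev_r: "\<forall>\<^sub>F p in F. C / \<epsilon> < r (fst p) (snd p)"
    using assms(11) by (simp add: filterlim_at_top_dense split_def)
  define bad where "bad n T = measure_pmf.prob (dsbm_pmf \<theta>\<^sub>0 n T)
      {(z, x). (MIN \<sigma> \<in> {\<sigma>. \<sigma> permutes (UNIV :: 'q set)}.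
          max_norm (snd \<theta>\<^sub>0 - permute_mat \<sigma> (snd (est n T x))))
        > \<epsilon> * r n T / real n powr (1 / 4)}" for n T
  have ev_bound: "\<forall>\<^sub>F p in F. bad (fst p) (snd p) \<le> bound (fst p)"
    using ev_T ev_n ev_gap ev_log ev_r
  proof eventually_elim
    case (elim p)
    define n T where "n = fst p" and "T = snd p"
    have n: "1 \<le> n" "4 * ?Q / \<delta> \<le> n" and T: "1 \<le> T"
      using elim(1,2) by (auto simp: n_def T_def)
    let ?S = "{(z :: 'q labels, x). (MIN \<sigma> \<in> {\<sigma>. \<sigma> permutes (UNIV :: 'q set)}.
        max_norm (snd \<theta>\<^sub>0 - permute_mat \<sigma> (snd (est n T x)))) > \<epsilon> * r n T / real n powr (1 / 4)}"
    have gap: "\<exists>l. 2 * (rate_const \<delta> \<zeta> CARD('q) * real n powr (- 1 / 4)) < \<bar>snd \<theta>\<^sub>0 $ q $ l - snd \<theta>\<^sub>0 $ q' $ l\<bar>"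
      if "q \<noteq> q'" for q q'
      using \<gamma>(2)[OF that] less_le_trans[OF elim(3)] unfolding C_def n_def by blast
    have less: "C * real n powr (- 1 / 4) < \<epsilon> * r n T / real n powr (1 / 4)"
      using elim(5) n(1) assms(13) by (simp add: n_def T_def powr_minus field_simps)
    have close: "(MIN \<sigma> \<in> {\<sigma>. \<sigma> permutes (UNIV :: 'q set)}.
        max_norm (snd \<theta>\<^sub>0 - permute_mat \<sigma> (snd (est n T x)))) \<le> C * real n powr (- 1 / 4)"
      if "(z, x) \<in> good_event \<delta> (snd \<theta>\<^sub>0) n T" for z x
      unfolding C_def
      by (rule mle_close[OF \<theta>\<^sub>0(1) assms(7,2) \<open>\<delta> < 1\<close> assms(4) \<open>\<zeta> < 1\<close> T n(2) gap that])
    have "?S \<subseteq> - good_event \<delta> (snd \<theta>\<^sub>0) n T"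
    proof (rule subsetI, rule ComplI)
      fix y assume y: "y \<in> ?S" "y \<in> good_event \<delta> (snd \<theta>\<^sub>0) n T"
      obtain z x where zx: "y = (z, x)"
        by (cases y)
      show False
        using y(1) less close[OF y(2)[unfolded zx]] unfolding zx mem_Collect_eq prod.case by linarith
    qed
    then have "bad n T \<le> measure_pmf.prob (dsbm_pmf \<theta>\<^sub>0 n T) (- good_event \<delta> (snd \<theta>\<^sub>0) n T)"
      unfolding bad_def by (intro measure_pmf.finite_measure_mono) auto
    also have "\<dots> \<le> real T * ?Q * exp (- \<delta>\<^sup>2 * n / 2) + 2 * ?Q ^ 2 * exp (- real n)"
      using prob_not_good_event[OF \<theta>\<^sub>0(1) assms(2,4) n(1) T] by simp
    \<comment> \<open>Half of the exponent absorbs the union bound over the times.\<close>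
    also have "real T * ?Q * exp (- \<delta>\<^sup>2 * n / 2) \<le> ?Q * exp (- (\<delta>\<^sup>2 / 4) * n)"
    proof -
      have "ln (real T) \<le> \<delta>\<^sup>2 / 4 * n"
        using elim(4) by (auto simp: n_def T_def)
      then have "exp (ln (real T)) \<le> exp (\<delta>\<^sup>2 / 4 * n)"
        by (simp only: exp_le_cancel_iff)
      then have "real T \<le> exp (\<delta>\<^sup>2 / 4 * n)"
        using T by simp
      then have "real T * exp (- \<delta>\<^sup>2 * n / 2) \<le> exp (\<delta>\<^sup>2 / 4 * n) * exp (- \<delta>\<^sup>2 * n / 2)"
        by (intro mult_right_mono) auto
      also have "\<dots> = exp (- (\<delta>\<^sup>2 / 4) * n)"
        by (simp flip: exp_add)
      finally have "?Q * (real T * exp (- \<delta>\<^sup>2 * n / 2)) \<le> ?Q * exp (- (\<delta>\<^sup>2 / 4) * n)"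
        by (intro mult_left_mono) auto
      then show ?thesis by (simp add: mult_ac)
    qed
    finally show ?case
      by (simp add: bound_def n_def T_def)
  qed
  have bound_lim: "((\<lambda>p. bound (real (fst p))) \<longlongrightarrow> 0) F"
  proof (rule filterlim_compose[OF _ n_lim])
    have "((\<lambda>n. exp (- c * n)) \<longlongrightarrow> 0) at_top" if "0 < c" for c :: real
      using that
      by (intro filterlim_compose[OF exp_at_bot] filterlim_tendsto_neg_mult_at_bot[OF tendsto_const])
        (auto intro: filterlim_ident)
    from this[of "\<delta>\<^sup>2 / 4"] this[of 1] have "(bound \<longlongrightarrow> ?Q * 0 + 2 * ?Q ^ 2 * 0) at_top"
      unfolding bound_def using assms(2) by (intro tendsto_intros) auto
    then show "(bound \<longlongrightarrow> 0) at_top"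
      by simp
  qed
  have "((\<lambda>p. bad (fst p) (snd p)) \<longlongrightarrow> 0) F"
    by (rule tendsto_sandwich[OF always_eventually ev_bound tendsto_const bound_lim]) (simp add: bad_def)
  then have "((\<lambda>(n, T). bad n T) \<longlongrightarrow> 0) F"
    by (simp add: split_def)
  then show ?thesis
    unfolding bad_def .
qed

end
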